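(* Let $\alpha,\beta,\gamma,\tau\in\mathbb{R}$, $n\in\mathbb{N}$, $n\geq 2$, and $f\in C_0^\infty(\mathbb{R}^n\backslash\{0\})$. Then $$\begin{aligned} &\int_{\mathbb{R}^n}|x|^\gamma |(\Delta f)(x)|^2\, d^nx\geq [\alpha(\gamma+n-4)-2\beta]\int_{\mathbb{R}^n}|x|^{\gamma-2}|(\nabla f)(x)|^2\, d^nx \\ &\quad-\alpha(\alpha-4+2\gamma)\int_{\mathbb{R}^n}|x|^{\gamma-4}|x\cdot(\nabla f)(x)|^2\, d^nx \\ &\quad+\beta[(n-4)(\alpha-2)-\beta+\gamma(n+\alpha+\gamma-6)]\int_{\mathbb{R}^n}|x|^{\gamma-4}|f(x)|^2\, d^nx \\ &\quad-\tau[(\gamma+n-4)(2-\alpha-\gamma)+2\beta]\int_0^\infty\int_{\mathbb{S}^{n-1}}r^{\gamma-4}\big|\big((-\Delta_{\mathbb{S}^{n-1}})^{1/2}f\big)(r,\theta)\big|^2\, d^{n-1}\omega(\theta)\, r^{n-1}dr \\ &\quad-2\tau\int_0^\infty\int_{\mathbb{S}^{n-1}}r^{\gamma-2}\Big|\Big((-\Delta_{\mathbb{S}^{n-1}})^{1/2}\frac{\partial f}{\partial r}\Big)(r,\theta)\Big|^2\, d^{n-1}\omega(\theta)\, r^{n-1}dr \\ &\quad-\tau(\tau+2)\int_0^\infty\int_{\mathbb{S}^{n-1}}r^{\gamma-4}|(\Delta_{\mathbb{S}^{n-1}} f)(r,\theta)|^2\, d^{n-1}\omega(\theta)\, r^{n-1}dr.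 \end{aligned}$$ In addition, if $\alpha(\alpha-4+2\gamma)\geq 0$, then $$\begin{aligned} &\int_{\mathbb{R}^n}|x|^\gamma|(\Delta f)(x)|^2\, d^nx \geq [\alpha(n-\alpha-\gamma)-2\beta]\int_{\mathbb{R}^n}|x|^{\gamma-2}|(\nabla f)(x)|^2\, d^nx \\ &\quad+\beta[(n-4)(\alpha-2)-\beta+\gamma(n+\alpha+\gamma-6)]\int_{\mathbb{R}^n}|x|^{\gamma-4}|f(x)|^2\, d^nx \\ &\quad-\tau[(\gamma+n-4)(2-\alpha-\gamma)+2\beta]\int_0^\infty\int_{\mathbb{S}^{n-1}}r^{\gamma-4}\big|\big((-\Delta_{\mathbb{S}^{n-1}})^{1/2}f\big)(r,\theta)\big|^2\, d^{n-1}\omega(\theta)\, r^{n-1}dr \\ &\quad-2\tau\int_0^\infty\int_{\mathbb{S}^{n-1}}r^{\gamma-2}\Big|\Big((-\Delta_{\mathbb{S}^{n-1}})^{1/2}\frac{\partial f}{\partial r}\Big)(r,\theta)\Big|^2\, d^{n-1}\omega(\theta)\, r^{n-1}dr \\ &\quad-\tau(\tau+2)\int_0^\infty\int_{\mathbb{S}^{n-1}}r^{\gamma-4}|(\Delta_{\mathbb{S}^{n-1}} f)(r,\theta)|^2\, d^{n-1}\omega(\theta)\, r^{n-1}dr. \end{aligned}$$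
   Context: $C_0^\infty(\mathbb{R}^n\backslash\{0\})$ denotes the complex-valued infinitely differentiable functions with compact support contained in $\mathbb{R}^n\backslash\{0\}$. Polar coordinates $x=r\theta$, $r=|x|>0$, $\theta\in\mathbb{S}^{n-1}$ (the unit sphere in $\mathbb{R}^n$) are used and $f(r,\theta)$ means $f(r\theta)$; $d^{n-1}\omega$ is the usual volume measure on $\mathbb{S}^{n-1}$. $-\Delta_{\mathbb{S}^{n-1}}$ is the nonnegative self-adjoint Laplace–Beltrami operator in $L^2(\mathbb{S}^{n-1};d^{n-1}\omega)$, so that $-\Delta=-\frac{\partial^2}{\partial r^2}-\frac{n-1}{r}\frac{\partial}{\partial r}-\frac{1}{r^2}\Delta_{\mathbb{S}^{n-1}}$, and $(-\Delta_{\mathbb{S}^{n-1}})^{1/2}$ is its nonnegative self-adjoint square root; these operators act on functions of $(r,\theta)$ in the variable $\theta$ for each fixed $r$. *)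

theory Defs
  imports "HOL-Analysis.Analysis"
begin

definition partial_deriv ::
    "'a::euclidean_space \<Rightarrow> ('a \<Rightarrow> complex) \<Rightarrow> 'a \<Rightarrow> complex" where
  "partial_deriv b f x = frechet_derivative f (at x) b"

text \<open>To be used for open sets only. Total differentiability of every iterated partial derivative
  implies continuity of all of them, so this is membership in the usual space of infinitely
  differentiable functions.\<close>

definition smooth_on :: "'a::euclidean_space set \<Rightarrow> ('a \<Rightarrow> complex) \<Rightarrow> bool" where
  "smooth_on S f \<longleftrightarrow>
     (\<forall>bs. set bs \<subseteq> Basis \<longrightarrow> (\<forall>x\<in>S. foldr partial_deriv bs f differentiable at x))"

definition test_function :: "'a::euclidean_space set \<Rightarrow> ('a \<Rightarrow> complex) \<Rightarrow> bool" where
  "test_function S f \<longleftrightarrow>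
     smooth_on S f \<and> compact (closure {x. f x \<noteq> 0}) \<and> closure {x. f x \<noteq> 0} \<subseteq> S"

definition laplacian :: "('a::euclidean_space \<Rightarrow> complex) \<Rightarrow> 'a \<Rightarrow> complex" where
  "laplacian f x = (\<Sum>b\<in>Basis. partial_deriv b (partial_deriv b f) x)"

definition grad_norm :: "('a::euclidean_space \<Rightarrow> complex) \<Rightarrow> 'a \<Rightarrow> real" where
  "grad_norm f x = sqrt (\<Sum>b\<in>Basis. (cmod (partial_deriv b f x))\<^sup>2)"

definition x_dot_grad :: "('a::euclidean_space \<Rightarrow> complex) \<Rightarrow> 'a \<Rightarrow> complex" where
  "x_dot_grad f x = (\<Sum>b\<in>Basis. of_real (x \<bullet> b) * partial_deriv b f x)"

text \<open>The surface measure of a subset of the unit sphere is the dimension times the volume of the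
  part of the unit ball lying on the rays through that subset.\<close>

definition sphere_measure :: "'a::euclidean_space measure" where
  "sphere_measure =
     scale_measure (of_nat DIM('a))
       (distr (restrict_space lborel (ball 0 1 - {0})) (restrict_space borel (sphere 0 1))
         (\<lambda>x. x /\<^sub>R norm x))"

text \<open>Integration in polar coordinates, as an iterated integral.\<close>

definition polar_integral :: "(real \<Rightarrow> 'a::euclidean_space \<Rightarrow> real) \<Rightarrow> real" where
  "polar_integral F =
     (LINT r:{0<..}|lborel. (LINT \<theta>|sphere_measure. F r \<theta>) * r ^ (DIM('a) - 1))"

definition radial_deriv :: "('a::euclidean_space \<Rightarrow> complex) \<Rightarrow> real \<Rightarrow> 'a \<Rightarrow> complex" where
  "radial_deriv f r \<theta> = vector_derivative (\<lambda>s. f (s *\<^sub>R \<theta>)) (at r)"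

text \<open>Elements of the Hilbert space of square integrable functions are represented by functions
  rather than by classes modulo null sets. An unbounded operator is represented by its graph, a set
  of pairs of functions; closures and adjoints are saturated under equality almost everywhere.\<close>

definition L2_fun :: "'a measure \<Rightarrow> ('a \<Rightarrow> complex) set" where
  "L2_fun M = {u \<in> borel_measurable M. integrable M (\<lambda>x. (cmod (u x))\<^sup>2)}"

definition L2_inner :: "'a measure \<Rightarrow> ('a \<Rightarrow> complex) \<Rightarrow> ('a \<Rightarrow> complex) \<Rightarrow> complex" where
  "L2_inner M u v = (LINT x|M. u x * cnj (v x))"

definition L2_dist :: "'a measure \<Rightarrow> ('a \<Rightarrow> complex) \<Rightarrow> ('a \<Rightarrow> complex) \<Rightarrow> real" where
  "L2_dist M u v = sqrt (LINT x|M. (cmod (u x - v x))\<^sup>2)"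

type_synonym 'a op_graph = "(('a \<Rightarrow> complex) \<times> ('a \<Rightarrow> complex)) set"

definition op_closure :: "'a measure \<Rightarrow> 'a op_graph \<Rightarrow> 'a op_graph" where
  "op_closure M T =
     {(u, v). u \<in> L2_fun M \<and> v \<in> L2_fun M \<and>
        (\<forall>e>0. \<exists>(p, q)\<in>T. L2_dist M p u < e \<and> L2_dist M q v < e)}"

definition op_adjoint :: "'a measure \<Rightarrow> 'a op_graph \<Rightarrow> 'a op_graph" where
  "op_adjoint M T =
     {(u, v). u \<in> L2_fun M \<and> v \<in> L2_fun M \<and>
        (\<forall>(p, q)\<in>T. L2_inner M q u = L2_inner M p v)}"

definition densely_defined :: "'a measure \<Rightarrow> 'a op_graph \<Rightarrow> bool" where
  "densely_defined M T \<longleftrightarrow>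
     (\<forall>u\<in>L2_fun M. \<forall>e>0. \<exists>p\<in>Domain T. L2_dist M p u < e)"

definition self_adjoint_op :: "'a measure \<Rightarrow> 'a op_graph \<Rightarrow> bool" where
  "self_adjoint_op M T \<longleftrightarrow> densely_defined M T \<and> op_adjoint M T = T"

text \<open>For self-adjoint operators the inner product below is automatically real.\<close>

definition nonneg_op :: "'a measure \<Rightarrow> 'a op_graph \<Rightarrow> bool" where
  "nonneg_op M T \<longleftrightarrow> (\<forall>(p, q)\<in>T. 0 \<le> Re (L2_inner M q p))"

text \<open>A nonnegative self-adjoint operator has exactly one square root in the following sense. The
  relational composition is the product of unbounded operators with its natural domain.\<close>

definition is_nonneg_sqrt :: "'a measure \<Rightarrow> 'a op_graph \<Rightarrow> 'a op_graph \<Rightarrow> bool" where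
  "is_nonneg_sqrt M B A \<longleftrightarrow> self_adjoint_op M B \<and> nonneg_op M B \<and> B O B = A"

text \<open>A representative of the value; integrals over \<open>M\<close> do not depend on the choice.\<close>

definition op_apply :: "'a op_graph \<Rightarrow> ('a \<Rightarrow> complex) \<Rightarrow> 'a \<Rightarrow> complex" where
  "op_apply T u = (SOME v. (u, v) \<in> T)"

text \<open>Functions on the sphere are handled through their extension that is constant along rays.
  For such an extension the radial part of the Laplacian vanishes, so on the unit sphere its
  Laplacian is the Laplace-Beltrami operator applied to the given function. Values of \<open>u\<close> off
  the unit sphere are irrelevant.\<close>

definition ray_extension :: "('a::euclidean_space \<Rightarrow> complex) \<Rightarrow> 'a \<Rightarrow> complex" where
  "ray_extension u x = u (x /\<^sub>R norm x)"

definition smooth_on_sphere :: "('a::euclidean_space \<Rightarrow> complex) \<Rightarrow> bool" where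
  "smooth_on_sphere u \<longleftrightarrow> smooth_on (- {0}) (ray_extension u)"

definition laplace_beltrami :: "('a::euclidean_space \<Rightarrow> complex) \<Rightarrow> 'a \<Rightarrow> complex" where
  "laplace_beltrami u \<theta> = laplacian (ray_extension u) \<theta>"

text \<open>The self-adjoint realization of minus the Laplace-Beltrami operator: the closure of its
  restriction to smooth functions, which is essentially self-adjoint as the sphere is compact.\<close>

definition neg_laplace_beltrami_op :: "'a::euclidean_space op_graph" where
  "neg_laplace_beltrami_op =
     op_closure sphere_measure {(u, \<lambda>\<theta>. - laplace_beltrami u \<theta>) | u. smooth_on_sphere u}"

end

theory Submission
  imports Defs
begin

text \<open>Write \<open>E = x \<cdot> \<nabla>\<close> for the Euler operator and \<open>\<Lambda> = |x|\<^sup>2 \<Delta> - E\<^sup>2 - (n - 2) E\<close> for the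
  Laplace-Beltrami operator acting on all spheres about the origin. Both inequalities come from
  expanding the nonnegative integral of
  \<open>|x|\<^bsup>\<gamma>-4\<^esup> |E\<^sup>2f + (n - 2 - \<alpha>) Ef - \<beta> f + (1 + \<tau>) \<Lambda>f|\<^sup>2\<close>.
  The cross terms are evaluated by the integration by parts
  \<open>\<integral> |x|\<^sup>s Eh = -(n + s) \<integral> |x|\<^sup>s h\<close>, the relation \<open>E\<Lambda> = \<Lambda>E\<close>, and the symmetry of \<open>\<Lambda>\<close> on each sphere, which
  together with the norms of the square root is read off from the self-adjointness of \<open>B\<close> alone.
  The second inequality follows from the first by \<open>|x \<cdot> \<nabla>f| \<le> |x| |\<nabla>f|\<close>.\<close>

subsection \<open>Smooth functions and test functions\<close>

text \<open>For \<alpha> = \<beta> = \<tau> = 0 the square is | |x|^2 \<Delta>f |^2, and the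
  exponent \<gamma> - 4 compensates the factor |x|^4. The parameters thus only shift the
  coefficients of Ef, f and \<Lambda>f away from n - 2, 0 and 1, while that of E^2 f stays 1. The
  two weighted square integrals differ by an exact identity, whose terms are those of the first
  inequality; nonnegativity is the only estimate made there. Using E instead of the radial
  derivative keeps every function a test function on the whole space, so integration by parts takes
  place in Cartesian coordinates and without boundary terms. Polar coordinates serve only to compare
  sphere integrals with volume integrals. The obstacle is on the operator side:
  \<open>op_apply\<close> picks an arbitrary representative, so no pointwise statement about its
  values is available, only their integrals over spheres. For fixed r each such integral is
  identified with an inner product that involves only smooth functions. The slices of f are smooth
  and lie in the graph directly; density of the domain is used only to compare the chosen value of B
  with the one through which B O B factors.\<close>

lemma partial_deriv_eqI: "(f has_derivative f') (at x) \<Longrightarrow> partial_deriv b f x = f' b"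
  unfolding partial_deriv_def by (metis frechet_derivative_at)

lemma partial_deriv_cong:
  assumes "open S" "x \<in> S" "\<And>y. y \<in> S \<Longrightarrow> f y = g y"
  shows "partial_deriv b f x = partial_deriv b g x"
proof -
  have "(f has_derivative f') (at x) \<longleftrightarrow> (g has_derivative f') (at x)" for f'
    using assms by (metis has_derivative_transform_within_open)
  then show ?thesis
    unfolding partial_deriv_def frechet_derivative_def by simp
qed

lemma differentiable_cong_open:
  assumes "open S" "x \<in> S" "\<And>y. y \<in> S \<Longrightarrow> f y = g y" "f differentiable at x"
  shows "g differentiable at x"
proof -
  have "(g has_derivative f') (at x)" if "(f has_derivative f') (at x)" for f'
    using that assms(1,2,3) by (rule has_derivative_transform_within_open)
  with assms(4) show ?thesis
    unfolding differentiable_def by blast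
qed

lemma partial_deriv_add:
  assumes "f differentiable at x" "g differentiable at x"
  shows "partial_deriv b (\<lambda>x. f x + g x) x = partial_deriv b f x + partial_deriv b g x"
  using has_derivative_add[OF assms[unfolded frechet_derivative_works]]
  by (rule partial_deriv_eqI[THEN trans]) (simp add: partial_deriv_def)

lemma partial_deriv_mult:
  assumes "f differentiable at x" "g differentiable at x"
  shows "partial_deriv b (\<lambda>x. f x * g x) x = f x * partial_deriv b g x + partial_deriv b f x * g x"
  using has_derivative_mult[OF assms[unfolded frechet_derivative_works]]
  by (rule partial_deriv_eqI[THEN trans]) (simp add: partial_deriv_def)

lemma partial_deriv_const [simp]: "partial_deriv b (\<lambda>x. c) = (\<lambda>x. 0)"
  by (auto simp: partial_deriv_def)

lemma partial_deriv_sum: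
  assumes "\<And>i. i \<in> I \<Longrightarrow> f i differentiable at x"
  shows "partial_deriv b (\<lambda>x. \<Sum>i\<in>I. f i x) x = (\<Sum>i\<in>I. partial_deriv b (f i) x)"
proof -
  have "((\<lambda>x. \<Sum>i\<in>I. f i x) has_derivative (\<lambda>h. \<Sum>i\<in>I. frechet_derivative (f i) (at x) h)) (at x)"
    using assms by (intro has_derivative_sum) (simp add: frechet_derivative_works)
  then show ?thesis
    by (rule partial_deriv_eqI[THEN trans]) (simp add: partial_deriv_def)
qed

lemma partial_deriv_cnj:
  assumes "f differentiable at x"
  shows "partial_deriv b (\<lambda>x. cnj (f x)) x = cnj (partial_deriv b f x)"
  using bounded_linear.has_derivative[OF bounded_linear_cnj assms[unfolded frechet_derivative_works]]
  by (rule partial_deriv_eqI[THEN trans]) (simp add: partial_deriv_def)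

lemma differentiable_cnj:
  assumes "f differentiable at x"
  shows "(\<lambda>x. cnj (f x)) differentiable at x"
  using bounded_linear.has_derivative[OF bounded_linear_cnj assms[unfolded frechet_derivative_works]]
  by (rule differentiableI)

lemma has_derivative_of_real_inner:
  "((\<lambda>x. of_real (x \<bullet> c) :: complex) has_derivative (\<lambda>h. of_real (h \<bullet> c))) (at x)"
  by (auto intro!: derivative_eq_intros)

lemma has_derivative_of_real_inner_self:
  "((\<lambda>x. of_real (x \<bullet> x) :: complex) has_derivative (\<lambda>h. of_real (2 * (x \<bullet> h)))) (at x)"
  by (auto intro!: derivative_eq_intros simp: inner_commute)

text \<open>The gradient of |x|^p appears as p |x|^(p-2) x, without division by |x|, so it is again
  a weight of the same family times a linear function.\<close>

lemma has_derivative_norm_powr: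
  fixes x :: "'a::euclidean_space"
  assumes "x \<noteq> 0"
  shows "((\<lambda>x. of_real (norm x powr p) :: complex) has_derivative
           (\<lambda>h. of_real p * of_real (x \<bullet> h) * of_real (norm x powr (p - 2)))) (at x)"
proof -
  have "((\<lambda>x. norm x powr p) has_derivative
      (\<lambda>h. norm x powr p * (0 * ln (norm x) + (h \<bullet> sgn x) * p / norm x))) (at x)"
    by (rule has_derivative_powr)
       (use assms has_derivative_norm[OF assms] in \<open>auto simp: inner_commute\<close>)
  moreover have "norm x powr p * (0 * ln (norm x) + (h \<bullet> sgn x) * p / norm x)
      = p * (x \<bullet> h) * norm x powr (p - 2)" for h
  proof -
    have "norm x powr p = norm x powr (p - 2) * (norm x)\<^sup>2"
      using assms by (simp flip: powr_numeral powr_add)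
    then show ?thesis using assms
      by (simp add: sgn_div_norm inner_commute power2_eq_square)
  qed
  ultimately have "((\<lambda>x. norm x powr p) has_derivative (\<lambda>h. p * (x \<bullet> h) * norm x powr (p - 2))) (at x)"
    by simp
  from has_derivative_of_real[OF this, where 'a=complex] show ?thesis
    by simp
qed

lemma differentiable_scalars:
  fixes x :: "'a::euclidean_space"
  shows "(\<lambda>x. of_real (x \<bullet> c) :: complex) differentiable at x"
    and "(\<lambda>x. of_real (x \<bullet> x) :: complex) differentiable at x"
    and "x \<noteq> 0 \<Longrightarrow> (\<lambda>x. of_real (norm x powr p) :: complex) differentiable at x"
  using has_derivative_of_real_inner has_derivative_of_real_inner_self has_derivative_norm_powr
  unfolding differentiable_def by blast+

lemmas partial_deriv_inner = partial_deriv_eqI[OF has_derivative_of_real_inner]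
lemmas partial_deriv_inner_self = partial_deriv_eqI[OF has_derivative_of_real_inner_self]
lemmas partial_deriv_norm_powr = partial_deriv_eqI[OF has_derivative_norm_powr]

section \<open>Smoothness up to a finite order\<close>

primrec smooth_upto :: "nat \<Rightarrow> 'a::euclidean_space set \<Rightarrow> ('a \<Rightarrow> complex) \<Rightarrow> bool" where
  "smooth_upto 0 S f \<longleftrightarrow> (\<forall>x\<in>S. f differentiable at x)"
| "smooth_upto (Suc k) S f \<longleftrightarrow>
     (\<forall>x\<in>S. f differentiable at x) \<and> (\<forall>b\<in>Basis. smooth_upto k S (partial_deriv b f))"

text \<open>\<open>foldr\<close> applies the last element of the list to f first, while the
  recursion peels off the derivative taken first; hence lists are split at their end. The recursive
  form carries the inductions over the order, the list form makes monotonicity in the order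
  immediate.\<close>

lemma smooth_upto_iff:
  "smooth_upto k S f \<longleftrightarrow>
    (\<forall>bs. set bs \<subseteq> Basis \<longrightarrow> length bs \<le> k \<longrightarrow> (\<forall>x\<in>S. foldr partial_deriv bs f differentiable at x))"
proof (induction k arbitrary: f)
  case 0
  then show ?case by simp
next
  case (Suc k)
  show ?case
  proof
    assume L: "smooth_upto (Suc k) S f"
    show "\<forall>bs. set bs \<subseteq> Basis \<longrightarrow> length bs \<le> Suc k \<longrightarrow> (\<forall>x\<in>S. foldr partial_deriv bs f differentiable at x)"
    proof (intro allI impI)
      fix bs :: "'a list" assume bs: "set bs \<subseteq> Basis" "length bs \<le> Suc k"
      show "\<forall>x\<in>S. foldr partial_deriv bs f differentiable at x"
        using L bs by (cases bs rule: rev_cases) (auto simp: Suc.IH)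
    qed
  next
    assume R: "\<forall>bs. set bs \<subseteq> Basis \<longrightarrow> length bs \<le> Suc k \<longrightarrow> (\<forall>x\<in>S. foldr partial_deriv bs f differentiable at x)"
    have "smooth_upto k S (partial_deriv b f)" if "b \<in> Basis" for b
      unfolding Suc.IH
    proof (intro allI impI)
      fix bs :: "'a list" assume "set bs \<subseteq> Basis" "length bs \<le> k"
      then show "\<forall>x\<in>S. foldr partial_deriv bs (partial_deriv b f) differentiable at x"
        using R[rule_format, of "bs @ [b]"] that by auto
    qed
    moreover have "\<forall>x\<in>S. f differentiable at x"
      using R[rule_format, of "[]"] by simp
    ultimately show "smooth_upto (Suc k) S f" by simp
  qed
qed

lemma smooth_on_iff_upto: "smooth_on S f \<longleftrightarrow> (\<forall>k. smooth_upto k S f)"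
  unfolding smooth_on_def smooth_upto_iff by blast

lemma smooth_upto_differentiable: "smooth_upto k S f \<Longrightarrow> x \<in> S \<Longrightarrow> f differentiable at x"
  by (cases k) auto

lemma smooth_upto_Suc_imp: "smooth_upto (Suc k) S f \<Longrightarrow> smooth_upto k S f"
  by (simp add: smooth_upto_iff)

lemma smooth_upto_cong:
  assumes "open S" "\<And>x. x \<in> S \<Longrightarrow> f x = g x" "smooth_upto k S f"
  shows "smooth_upto k S g"
  using assms(2,3)
proof (induction k arbitrary: f g)
  case 0
  then show ?case using differentiable_cong_open[OF assms(1) _ 0(1)] by simp
next
  case (Suc k)
  have "smooth_upto k S (partial_deriv b g)" if "b \<in> Basis" for b
    by (rule Suc.IH[of "partial_deriv b f"], erule partial_deriv_cong[OF assms(1) _ Suc.prems(1)])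
       (use Suc.prems(2) that in simp_all)
  then show ?case
    using Suc.prems(2) differentiable_cong_open[OF assms(1) _ Suc.prems(1)] by simp
qed

lemma smooth_upto_const [simp]: "smooth_upto k S (\<lambda>x. c)"
  by (induction k arbitrary: c) auto

lemma smooth_upto_add:
  assumes "open S" "smooth_upto k S f" "smooth_upto k S g"
  shows "smooth_upto k S (\<lambda>x. f x + g x)"
  using assms(2,3)
proof (induction k arbitrary: f g)
  case (Suc k)
  have "smooth_upto k S (partial_deriv b (\<lambda>x. f x + g x))" if "b \<in> Basis" for b
    by (rule smooth_upto_cong[OF assms(1) _ Suc.IH[of "partial_deriv b f" "partial_deriv b g"]])
       (use Suc.prems that in \<open>auto simp: partial_deriv_add\<close>)
  then show ?case using Suc.prems by auto
qed auto

text \<open>The product rule leaves one factor undifferentiated in each summand;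
  \<open>smooth_upto_Suc_imp\<close> lowers its order so that the induction hypothesis applies to
  both factors.\<close>

lemma smooth_upto_mult:
  assumes "open S" "smooth_upto k S f" "smooth_upto k S g"
  shows "smooth_upto k S (\<lambda>x. f x * g x)"
  using assms(2,3)
proof (induction k arbitrary: f g)
  case (Suc k)
  have "smooth_upto k S (partial_deriv b (\<lambda>x. f x * g x))" if "b \<in> Basis" for b
    by (rule smooth_upto_cong[OF assms(1) _ smooth_upto_add[OF assms(1)
          Suc.IH[of "f" "partial_deriv b g"] Suc.IH[of "partial_deriv b f" g]]])
       (use Suc.prems that smooth_upto_Suc_imp in \<open>auto simp: partial_deriv_mult\<close>)
  then show ?case using Suc.prems by (auto intro!: differentiable_mult)
qed (auto intro!: differentiable_mult)

lemma smooth_upto_cnj: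
  assumes "open S" "smooth_upto k S f"
  shows "smooth_upto k S (\<lambda>x. cnj (f x))"
  using assms(2)
proof (induction k arbitrary: f)
  case (Suc k)
  have "smooth_upto k S (partial_deriv b (\<lambda>x. cnj (f x)))" if "b \<in> Basis" for b
    by (rule smooth_upto_cong[OF assms(1) _ Suc.IH[of "partial_deriv b f"]])
       (use Suc.prems that in \<open>auto simp: partial_deriv_cnj\<close>)
  then show ?case using Suc.prems by (auto intro!: differentiable_cnj)
qed (auto intro!: differentiable_cnj)

lemma smooth_upto_inner: "smooth_upto k S (\<lambda>x. of_real (x \<bullet> c))"
proof (cases k)
  case (Suc k)
  have "partial_deriv b (\<lambda>x. of_real (x \<bullet> c)) = (\<lambda>x. of_real (b \<bullet> c))" for b
    by (simp add: fun_eq_iff partial_deriv_inner)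
  with Suc show ?thesis by (simp add: differentiable_scalars)
qed (simp add: differentiable_scalars)

text \<open>Each derivative turns the exponent p into p - 2 and adds a linear factor, so the
  induction keeps the exponent arbitrary.\<close>

lemma smooth_upto_norm_powr: "smooth_upto k (- {0}) (\<lambda>x. of_real (norm x powr p))"
proof (induction k arbitrary: p)
  case (Suc k)
  have "smooth_upto k (- {0}) (partial_deriv b (\<lambda>x. of_real (norm x powr p)))" for b :: 'a
    by (rule smooth_upto_cong[OF _ _ smooth_upto_mult[OF _ smooth_upto_mult[OF _
            smooth_upto_const[of _ _ "of_real p"] smooth_upto_inner[of _ _ b]] Suc.IH[of "p - 2"]]])
       (auto simp: partial_deriv_norm_powr)
  then show ?case by (simp add: differentiable_scalars)
qed (simp add: differentiable_scalars)

lemma smooth_on_partial_deriv: "smooth_on S f \<Longrightarrow> b \<in> Basis \<Longrightarrow> smooth_on S (partial_deriv b f)"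
  by (simp add: smooth_on_iff_upto flip: all_simps) (metis smooth_upto.simps(2))

lemma smooth_on_differentiable: "smooth_on S f \<Longrightarrow> x \<in> S \<Longrightarrow> f differentiable at x"
  by (auto simp: smooth_on_iff_upto intro: smooth_upto_differentiable[of 0])

lemma smooth_on_cong:
  assumes "open S" "\<And>x. x \<in> S \<Longrightarrow> f x = g x" "smooth_on S f"
  shows "smooth_on S g"
  unfolding smooth_on_iff_upto
proof
  fix k
  have "smooth_upto k S f"
    using assms(3) by (simp add: smooth_on_iff_upto)
  with assms(1,2) show "smooth_upto k S g"
    by (rule smooth_upto_cong[of S f g k])
qed

lemma smooth_on_const: "smooth_on S (\<lambda>x. c)"
  unfolding smooth_on_iff_upto by simp

lemma smooth_on_add:
  "open S \<Longrightarrow> smooth_on S f \<Longrightarrow> smooth_on S g \<Longrightarrow> smooth_on S (\<lambda>x. f x + g x)"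
  by (simp add: smooth_on_iff_upto smooth_upto_add)

lemma smooth_on_mult:
  "open S \<Longrightarrow> smooth_on S f \<Longrightarrow> smooth_on S g \<Longrightarrow> smooth_on S (\<lambda>x. f x * g x)"
  by (simp add: smooth_on_iff_upto smooth_upto_mult)

lemma smooth_on_cnj: "open S \<Longrightarrow> smooth_on S f \<Longrightarrow> smooth_on S (\<lambda>x. cnj (f x))"
  by (simp add: smooth_on_iff_upto smooth_upto_cnj)

lemma smooth_on_inner: "smooth_on S (\<lambda>x. of_real (x \<bullet> c))"
  by (simp add: smooth_on_iff_upto smooth_upto_inner)

lemma smooth_on_norm_powr: "smooth_on (- {0}) (\<lambda>x. of_real (norm x powr p))"
  by (simp add: smooth_on_iff_upto smooth_upto_norm_powr)

section \<open>Test functions supported in an annulus\<close>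

abbreviation (input) punctured_test_function :: "('a::euclidean_space \<Rightarrow> complex) \<Rightarrow> bool" where
  "punctured_test_function \<equiv> test_function (- {0})"

text \<open>A compact set missing the origin has positive distance from it. With the support
  described by two radii, closure properties reduce to comparing bounds and closures of sets no
  longer appear.\<close>

lemma punctured_test_function_iff:
  "punctured_test_function f \<longleftrightarrow>
     smooth_on (- {0}) f \<and> (\<exists>a>0. \<exists>b. \<forall>x. f x \<noteq> 0 \<longrightarrow> a \<le> norm x \<and> norm x \<le> b)"
proof
  assume L: "punctured_test_function f"
  let ?K = "closure {x. f x \<noteq> 0}"
  have K: "compact ?K" "0 \<notin> ?K" and s: "smooth_on (- {0}) f"
    using L by (auto simp: test_function_def)
  have "open (- ?K)" "0 \<in> - ?K"
    using K by auto
  then obtain a where a: "a > 0" "ball 0 a \<subseteq> - ?K"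
    by (meson open_contains_ball)
  obtain b where b: "\<And>x. x \<in> ?K \<Longrightarrow> norm x \<le> b"
    using K(1) compact_imp_bounded bounded_iff by metis
  have "\<forall>x. f x \<noteq> 0 \<longrightarrow> a \<le> norm x \<and> norm x \<le> b"
    using closure_subset[of "{x. f x \<noteq> 0}"] a b
    by (auto simp: subset_iff) (metis ComplD not_le)
  then show "smooth_on (- {0}) f \<and> (\<exists>a>0. \<exists>b. \<forall>x. f x \<noteq> 0 \<longrightarrow> a \<le> norm x \<and> norm x \<le> b)"
    using a s by blast
next
  assume R: "smooth_on (- {0}) f \<and> (\<exists>a>0. \<exists>b. \<forall>x. f x \<noteq> 0 \<longrightarrow> a \<le> norm x \<and> norm x \<le> b)"
  then obtain a b where ab: "a > 0" "\<And>x. f x \<noteq> 0 \<Longrightarrow> a \<le> norm x \<and> norm x \<le> b"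
    by blast
  have "closure {x. f x \<noteq> 0} \<subseteq> cball 0 b - ball 0 a"
    by (rule closure_minimal) (auto intro!: closed_Diff dest!: ab(2))
  moreover from this have "bounded (closure {x. f x \<noteq> 0})"
    by (meson bounded_cball bounded_diff bounded_subset)
  ultimately show "punctured_test_function f"
    using R ab by (auto simp: test_function_def compact_eq_bounded_closed)
qed

lemma test_function_smooth: "test_function S f \<Longrightarrow> smooth_on S f"
  by (simp add: test_function_def)

lemma test_function_support:
  assumes "punctured_test_function f"
  obtains a b where "a > 0" "b > 0" "\<And>x. f x \<noteq> 0 \<Longrightarrow> a \<le> norm x \<and> norm x \<le> b"
proof -
  obtain a b where "a > 0" "\<And>x. f x \<noteq> 0 \<Longrightarrow> a \<le> norm x \<and> norm x \<le> b"
    using assms unfolding punctured_test_function_iff by blast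
  then show ?thesis using that[of a "max b 1"] by force
qed

text \<open>Smoothness is given off the origin only, but f vanishes on a ball about it. Test
  functions can therefore be differentiated everywhere, and only the weights |x|^s force case
  distinctions at 0.\<close>

lemma test_function_differentiable:
  assumes "punctured_test_function f"
  shows "f differentiable at x"
proof (cases "x = 0")
  case False
  then show ?thesis
    using assms smooth_on_differentiable test_function_smooth by blast
next
  case True
  obtain a b where "a > 0" "\<And>x. f x \<noteq> 0 \<Longrightarrow> a \<le> norm x \<and> norm x \<le> b"
    using assms by (metis test_function_support)
  then show ?thesis
    by (intro differentiable_cong_open[of "ball 0 a" x "\<lambda>_. 0" f]) (use True in \<open>auto, force\<close>)
qed

text \<open>The complement of the closed annulus is open and f vanishes on it, so the derivative
  does too and the same two radii serve.\<close>

lemma test_function_partial_deriv: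
  assumes "punctured_test_function f" "b \<in> Basis"
  shows "punctured_test_function (partial_deriv b f)"
proof -
  obtain a c where ac: "a > 0" "\<And>x. f x \<noteq> 0 \<Longrightarrow> a \<le> norm x \<and> norm x \<le> c"
    using assms by (metis test_function_support)
  let ?K = "cball 0 c - ball 0 a"
  have "partial_deriv b f x = 0" if "x \<notin> ?K" for x
  proof -
    have "f y = 0" if "y \<in> - ?K" for y
      using that ac(2)[of y] by (cases "f y = 0") auto
    moreover have "open (- ?K)"
      by (intro open_Compl closed_Diff) auto
    ultimately show ?thesis
      using partial_deriv_cong[of "- ?K" x f "\<lambda>_. 0"] that by simp
  qed
  then have "\<forall>x. partial_deriv b f x \<noteq> 0 \<longrightarrow> a \<le> norm x \<and> norm x \<le> c"
    by (metis Diff_iff mem_ball_0 mem_cball_0 not_le)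
  then show ?thesis
    using assms ac smooth_on_partial_deriv unfolding punctured_test_function_iff by blast
qed

lemma test_function_mult:
  assumes "smooth_on (- {0}) g" "punctured_test_function f"
  shows "punctured_test_function (\<lambda>x. g x * f x)"
proof -
  obtain a c where ac: "a > 0" "\<And>x. f x \<noteq> 0 \<Longrightarrow> a \<le> norm x \<and> norm x \<le> c"
    using assms by (metis test_function_support)
  then show ?thesis
    using assms smooth_on_mult[of "- {0}" g f]
    unfolding punctured_test_function_iff by (metis mult_zero_right open_delete open_UNIV Compl_eq_Diff_UNIV)
qed

lemma test_function_cmult: "punctured_test_function f \<Longrightarrow> punctured_test_function (\<lambda>x. c * f x)"
  by (intro test_function_mult smooth_on_const)

lemma test_function_add:
  assumes "punctured_test_function f" "punctured_test_function g"
  shows "punctured_test_function (\<lambda>x. f x + g x)"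
proof -
  obtain a c where ac: "a > 0" "\<And>x. f x \<noteq> 0 \<Longrightarrow> a \<le> norm x \<and> norm x \<le> c"
    using assms by (metis test_function_support)
  obtain a' c' where ac': "a' > 0" "\<And>x. g x \<noteq> 0 \<Longrightarrow> a' \<le> norm x \<and> norm x \<le> c'"
    using assms by (metis test_function_support)
  have "\<forall>x. f x + g x \<noteq> 0 \<longrightarrow> min a a' \<le> norm x \<and> norm x \<le> max c c'"
    using ac(2) ac'(2) by (metis add.right_neutral max.coboundedI1 max.coboundedI2 min.coboundedI1 min.coboundedI2 add.left_neutral)
  moreover have "min a a' > 0" using ac ac' by simp
  ultimately show ?thesis
    using assms smooth_on_add[of "- {0}" f g]
    unfolding punctured_test_function_iff by (metis open_delete open_UNIV Compl_eq_Diff_UNIV)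
qed

lemma test_function_zero: "punctured_test_function (\<lambda>x. 0)"
  unfolding punctured_test_function_iff by (auto simp: smooth_on_const intro!: exI[of _ 1])

lemma test_function_sum:
  "(\<And>i. i \<in> I \<Longrightarrow> punctured_test_function (f i)) \<Longrightarrow> punctured_test_function (\<lambda>x. \<Sum>i\<in>I. f i x)"
  by (induction I rule: infinite_finite_induct) (auto intro!: test_function_add simp: test_function_zero)

lemma test_function_diff:
  assumes "punctured_test_function f" "punctured_test_function g"
  shows "punctured_test_function (\<lambda>x. f x - g x)"
  using test_function_add[OF assms(1) test_function_cmult[OF assms(2), of "-1"]] by simp

lemma test_function_cnj:
  assumes "punctured_test_function f"
  shows "punctured_test_function (\<lambda>x. cnj (f x))"
  using assms smooth_on_cnj[of "- {0}" f] unfolding punctured_test_function_iff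
  by (metis complex_cnj_zero_iff open_delete open_UNIV Compl_eq_Diff_UNIV)

lemma test_function_x_dot_grad:
  "punctured_test_function f \<Longrightarrow> punctured_test_function (x_dot_grad f)"
  unfolding x_dot_grad_def[abs_def]
  by (intro test_function_sum test_function_mult smooth_on_inner test_function_partial_deriv)

lemma test_function_laplacian:
  "punctured_test_function f \<Longrightarrow> punctured_test_function (laplacian f)"
  unfolding laplacian_def[abs_def] by (intro test_function_sum test_function_partial_deriv)

lemma test_function_continuous_on:
  assumes "punctured_test_function f"
  shows "continuous_on A f"
  using test_function_differentiable[OF assms]
  by (meson continuous_at_imp_continuous_on differentiable_imp_continuous_within)

lemma test_function_integrable:
  assumes "punctured_test_function f"
  shows "integrable lborel f"
proof -
  obtain a c where ac: "a > 0" "\<And>x. f x \<noteq> 0 \<Longrightarrow> a \<le> norm x \<and> norm x \<le> c"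
    using assms by (metis test_function_support)
  have "integrable lborel (\<lambda>x. indicator (cball 0 c) x *\<^sub>R f x)"
    by (intro borel_integrable_compact test_function_continuous_on assms) simp
  moreover have "(\<lambda>x. indicator (cball 0 c) x *\<^sub>R f x) = f"
    using ac(2) by (force simp: indicator_def fun_eq_iff)
  ultimately show ?thesis by simp
qed

subsection \<open>Integrals and symmetry of partial derivatives\<close>

lemma smooth_on_scalars [simp]:
  "smooth_on S (\<lambda>x. c)" "smooth_on S (\<lambda>x. of_real (x \<bullet> b))"
  "smooth_on (- {0}) (\<lambda>x. of_real (norm x powr p))"
  by (rule smooth_on_const smooth_on_inner smooth_on_norm_powr)+

lemma open_punctured [simp]: "open (- {0::'a::euclidean_space})"
  by auto

lemma partial_deriv_has_vector_derivative:
  assumes "f differentiable at (x + t *\<^sub>R b)"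
  shows "((\<lambda>t. f (x + t *\<^sub>R b)) has_vector_derivative partial_deriv b f (x + t *\<^sub>R b)) (at t within T)"
proof -
  have "((\<lambda>t. f (x + t *\<^sub>R b)) has_derivative
      (\<lambda>h. frechet_derivative f (at (x + t *\<^sub>R b)) (h *\<^sub>R b))) (at t within T)"
    by (rule has_derivative_compose[of "\<lambda>t. x + t *\<^sub>R b" "\<lambda>h. h *\<^sub>R b" t T f])
       (use assms frechet_derivative_works in \<open>auto intro!: derivative_eq_intros\<close>)
  moreover have "frechet_derivative f (at (x + t *\<^sub>R b)) (h *\<^sub>R b) = h *\<^sub>R partial_deriv b f (x + t *\<^sub>R b)" for h
    unfolding partial_deriv_def
    using linear_frechet_derivative[OF assms] by (simp add: linear_scale)
  ultimately show ?thesis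
    by (simp add: has_vector_derivative_def)
qed

lemma bounded_test_function:
  assumes "punctured_test_function f"
  obtains C where "C > 0" "\<And>x. cmod (f x) \<le> C"
proof -
  obtain a c where ac: "a > 0" "\<And>x. f x \<noteq> 0 \<Longrightarrow> a \<le> norm x \<and> norm x \<le> c"
    using assms by (metis test_function_support)
  have "bounded (f ` cball 0 c)"
    by (intro compact_imp_bounded compact_continuous_image test_function_continuous_on assms) simp
  then obtain C where C: "C > 0" "\<And>x. x \<in> cball 0 c \<Longrightarrow> cmod (f x) \<le> C"
    unfolding bounded_pos by auto
  have "cmod (f x) \<le> C" for x
    using ac(2)[of x] C(1) C(2)[of x] by (cases "f x = 0") auto
  with C(1) that show ?thesis by blast
qed

text \<open>By translation invariance every difference quotient in direction b has integral zero;
  dominated convergence passes to the derivative. This replaces a Fubini argument along lines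
  parallel to b.\<close>

lemma integral_partial_deriv:
  assumes f: "punctured_test_function f" and b: "b \<in> Basis"
  shows "(LINT x|lborel. partial_deriv b f x) = 0"
proof -
  obtain a c where ac: "a > 0" "\<And>x. f x \<noteq> 0 \<Longrightarrow> a \<le> norm x \<and> norm x \<le> c"
    using f by (metis test_function_support)
  obtain C where C: "C > 0" "\<And>x. cmod (partial_deriv b f x) \<le> C"
    using bounded_test_function[OF test_function_partial_deriv[OF f b]] by blast
  \<comment> \<open>The increments are positive and at most 1, so all difference quotients are
    supported in the ball of radius c + 1, where the mean value inequality bounds them by the
    supremum C of the derivative.\<close>
  define t :: "nat \<Rightarrow> real" where "t n = 1 / real (Suc n)" for n
  have t: "t n > 0" "t n \<le> 1" for n
    by (auto simp: t_def)
  define g where "g n x = (f (x + t n *\<^sub>R b) - f x) / of_real (t n)" for n x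
  have m[measurable]: "f \<in> borel_measurable borel"
    by (intro borel_measurable_continuous_onI test_function_continuous_on f)
  have m'[measurable]: "partial_deriv b f \<in> borel_measurable borel"
    by (intro borel_measurable_continuous_onI test_function_continuous_on test_function_partial_deriv f b)
  have sh: "integrable lborel (\<lambda>x. f (x + v))" "(LINT x|lborel. f (x + v)) = (LINT x|lborel. f x)" for v
  proof -
    have "integrable (distr lborel borel ((+) v)) f"
      unfolding lborel_distr_plus by (rule test_function_integrable[OF f])
    then show "integrable lborel (\<lambda>x. f (x + v))"
      by (subst (asm) integrable_distr_eq) (auto simp: add.commute)
    have "(LINT x|lborel. f x) = (LINT x|distr lborel borel ((+) v). f x)"
      unfolding lborel_distr_plus ..
    also have "\<dots> = (LINT x|lborel. f (x + v))"
      by (subst integral_distr) (auto simp: add.commute)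
    finally show "(LINT x|lborel. f (x + v)) = (LINT x|lborel. f x)" ..
  qed
  have zero: "(LINT x|lborel. g n x) = 0" for n
    unfolding g_def using sh test_function_integrable[OF f] by simp
  have bd: "cmod (g n x) \<le> C * indicator (cball 0 (c + 1)) x" for n x
  proof (cases "x \<in> cball 0 (c + 1)")
    case True
    have "cmod (f (x + t n *\<^sub>R b) - f (x + 0 *\<^sub>R b)) \<le> C * norm (t n - 0)"
    proof (rule differentiable_bound[of "{0..t n}"])
      show "((\<lambda>s. f (x + s *\<^sub>R b)) has_derivative (\<lambda>h. h *\<^sub>R partial_deriv b f (x + s *\<^sub>R b))) (at s within {0..t n})" for s
        using partial_deriv_has_vector_derivative[OF test_function_differentiable[OF f]]
        by (simp add: has_vector_derivative_def)
      show "onorm (\<lambda>h. h *\<^sub>R partial_deriv b f (x + s *\<^sub>R b)) \<le> C" for s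
        by (rule onorm_le) (use C(2) in \<open>simp add: mult.commute[of C] mult_left_mono\<close>)
    qed (use t(1)[of n] in auto)
    then show ?thesis
      using t(1)[of n] True by (simp add: g_def norm_divide divide_le_eq)
  next
    case False
    have "norm x \<le> norm (x + t n *\<^sub>R b) + norm (t n *\<^sub>R b)"
      using norm_triangle_ineq4[of "x + t n *\<^sub>R b" "t n *\<^sub>R b"] by simp
    then have "norm (x + t n *\<^sub>R b) > c" "norm x > c"
      using False t[of n] b by auto
    then have "f (x + t n *\<^sub>R b) = 0" "f x = 0"
      using ac(2) by (meson not_le)+
    then show ?thesis using False by (simp add: g_def)
  qed
  have lim: "(\<lambda>n. g n x) \<longlonglongrightarrow> partial_deriv b f x" for x
  proof -
    have "((\<lambda>s. f (x + s *\<^sub>R b)) has_vector_derivative partial_deriv b f (x + 0 *\<^sub>R b)) (at 0)"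
      by (rule partial_deriv_has_vector_derivative[OF test_function_differentiable[OF f]])
    then have "((\<lambda>h. norm (f (x + h *\<^sub>R b) - f x - h *\<^sub>R partial_deriv b f x) / \<bar>h\<bar>) \<longlongrightarrow> 0) (at 0)"
      unfolding has_vector_derivative_def has_derivative_at by simp
    then have "((\<lambda>h. norm ((f (x + h *\<^sub>R b) - f x) /\<^sub>R h - partial_deriv b f x)) \<longlongrightarrow> 0) (at 0)"
    proof (rule Lim_transform_eventually)
      have "norm (f (x + h *\<^sub>R b) - f x - h *\<^sub>R partial_deriv b f x) / \<bar>h\<bar> =
          norm ((f (x + h *\<^sub>R b) - f x) /\<^sub>R h - partial_deriv b f x)" if "h \<noteq> 0" for h
      proof -
        have "(f (x + h *\<^sub>R b) - f x) /\<^sub>R h - partial_deriv b f x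
            = (f (x + h *\<^sub>R b) - f x - h *\<^sub>R partial_deriv b f x) /\<^sub>R h"
          using that by (simp add: scaleR_right_diff_distrib)
        then show ?thesis by (simp add: divide_inverse mult.commute)
      qed
      then show "\<forall>\<^sub>F h in at 0. norm (f (x + h *\<^sub>R b) - f x - h *\<^sub>R partial_deriv b f x) / \<bar>h\<bar> =
          norm ((f (x + h *\<^sub>R b) - f x) /\<^sub>R h - partial_deriv b f x)"
        by (auto simp: eventually_at_filter)
    qed
    then have "((\<lambda>h. (f (x + h *\<^sub>R b) - f x) /\<^sub>R h) \<longlongrightarrow> partial_deriv b f x) (at 0)"
      using tendsto_norm_zero_iff Lim_null by blast
    moreover have "filterlim t (at 0) sequentially"
      unfolding filterlim_at t_def using LIMSEQ_inverse_real_of_nat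
      by (auto simp: inverse_eq_divide intro!: always_eventually)
    ultimately have "(\<lambda>n. (f (x + t n *\<^sub>R b) - f x) /\<^sub>R t n) \<longlonglongrightarrow> partial_deriv b f x"
      by (rule filterlim_compose)
    then show ?thesis
      by (simp add: g_def scaleR_conv_of_real divide_inverse mult.commute)
  qed
  have "(\<lambda>n. LINT x|lborel. g n x) \<longlonglongrightarrow> (LINT x|lborel. partial_deriv b f x)"
  proof (rule integral_dominated_convergence[where w = "\<lambda>x. C * indicator (cball 0 (c + 1)) x"])
    show "integrable lborel (\<lambda>x::'a. C * indicator (cball 0 (c + 1)) x)"
      by (intro integrable_mult_right integrable_real_indicator emeasure_lborel_cball_finite) simp
  qed (use bd lim in \<open>auto simp: g_def[abs_def]\<close>)
  then show ?thesis
    unfolding zero by (rule LIMSEQ_unique[OF _ tendsto_const])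
qed

text \<open>The increment of f in direction a is the integral of its a-derivative over [0, s].
  Differentiating this in direction b under the integral sign expresses the increment of the
  b-derivative as an integral of \<open>?G\<close>, and differentiating that in s at 0 gives the
  claim.\<close>

lemma partial_deriv_commute:
  assumes f: "punctured_test_function f" and a: "a \<in> Basis" and b: "b \<in> Basis"
  shows "partial_deriv a (partial_deriv b f) x = partial_deriv b (partial_deriv a f) x"
proof -
  let ?G = "partial_deriv b (partial_deriv a f)"
  have fa: "punctured_test_function (partial_deriv a f)" and fb: "punctured_test_function (partial_deriv b f)"
    using f a b test_function_partial_deriv by blast+
  have G: "punctured_test_function ?G"
    by (intro test_function_partial_deriv f a b)
  note cont = test_function_continuous_on[of _ UNIV, THEN continuous_on_compose2]
  have eq: "partial_deriv b f (x + s *\<^sub>R a) - partial_deriv b f x = integral {0..s} (\<lambda>t. ?G (x + t *\<^sub>R a))"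
    if s: "s \<ge> 0" for s
  proof -
    have ftc: "integral {0..s} (\<lambda>t. partial_deriv a f ((x + u *\<^sub>R b) + t *\<^sub>R a))
       = f ((x + u *\<^sub>R b) + s *\<^sub>R a) - f (x + u *\<^sub>R b)" for u
      using fundamental_theorem_of_calculus[OF s
          partial_deriv_has_vector_derivative[OF test_function_differentiable[OF f], where x = "x + u *\<^sub>R b" and b = a]]
      by (simp add: integral_unique)
    have "((\<lambda>u. integral (cbox 0 s) (\<lambda>t. partial_deriv a f ((x + t *\<^sub>R a) + u *\<^sub>R b)))
       has_vector_derivative integral (cbox 0 s) (\<lambda>t. ?G ((x + t *\<^sub>R a) + 0 *\<^sub>R b))) (at 0 within UNIV)"
    proof (rule leibniz_rule_vector_derivative)
      show "((\<lambda>u. partial_deriv a f ((x + t *\<^sub>R a) + u *\<^sub>R b)) has_vector_derivative ?G ((x + t *\<^sub>R a) + u *\<^sub>R b)) (at u within UNIV)" for t u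
        by (rule partial_deriv_has_vector_derivative[OF test_function_differentiable[OF fa]])
      show "(\<lambda>t. partial_deriv a f ((x + t *\<^sub>R a) + u *\<^sub>R b)) integrable_on cbox 0 s" for u
        by (intro integrable_continuous cont[OF fa]) (auto intro!: continuous_intros)
      show "continuous_on (UNIV \<times> cbox 0 s) (\<lambda>(u, t). ?G ((x + t *\<^sub>R a) + u *\<^sub>R b))"
        unfolding split_beta by (intro cont[OF G]) (auto intro!: continuous_intros)
    qed auto
    moreover have "((\<lambda>u. f ((x + s *\<^sub>R a) + u *\<^sub>R b) - f (x + u *\<^sub>R b)) has_vector_derivative
         partial_deriv b f ((x + s *\<^sub>R a) + 0 *\<^sub>R b) - partial_deriv b f (x + 0 *\<^sub>R b)) (at 0)"
      by (intro has_vector_derivative_diff partial_deriv_has_vector_derivative test_function_differentiable f)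
    moreover have "(\<lambda>u. integral (cbox 0 s) (\<lambda>t. partial_deriv a f ((x + t *\<^sub>R a) + u *\<^sub>R b)))
       = (\<lambda>u. f ((x + s *\<^sub>R a) + u *\<^sub>R b) - f (x + u *\<^sub>R b))"
      using ftc by (simp add: fun_eq_iff ac_simps)
    ultimately show ?thesis
      using vector_derivative_unique_at by fastforce
  qed
  \<comment> \<open>The integral formula holds for s \<ge> 0 only, so both derivatives are taken
    within [0, 1] at its left endpoint, where a vector derivative is still unique.\<close>
  have "((\<lambda>s. integral {0..s} (\<lambda>t. ?G (x + t *\<^sub>R a))) has_vector_derivative ?G (x + 0 *\<^sub>R a)) (at 0 within {0..1})"
    by (rule integral_has_vector_derivative) (auto intro!: cont[OF G] continuous_intros)
  moreover have "((\<lambda>s. partial_deriv b f (x + s *\<^sub>R a) - partial_deriv b f x) has_vector_derivative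
      partial_deriv a (partial_deriv b f) (x + 0 *\<^sub>R a) - 0) (at 0 within {0..1})"
    by (intro has_vector_derivative_diff has_vector_derivative_const partial_deriv_has_vector_derivative
        test_function_differentiable fb)
  then have "((\<lambda>s. integral {0..s} (\<lambda>t. ?G (x + t *\<^sub>R a))) has_vector_derivative
      partial_deriv a (partial_deriv b f) (x + 0 *\<^sub>R a) - 0) (at 0 within {0..1})"
    by (rule has_vector_derivative_transform[rotated 2]) (auto simp: eq)
  ultimately show ?thesis
    using vector_derivative_unique_within_closed_interval[of 0 1 0] by force
qed

subsection \<open>Polar coordinates\<close>

lemma space_sphere_measure [simp]: "space sphere_measure = sphere 0 1"
  by (simp add: sphere_measure_def space_scale_measure space_restrict_space)

lemma sets_sphere_measure [measurable_cong]: "sets sphere_measure = sets (restrict_space borel (sphere 0 1))"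
  by (simp add: sphere_measure_def)

lemma measurable_sphere_measure_ident [measurable]: "(\<lambda>\<theta>. \<theta>) \<in> sphere_measure \<rightarrow>\<^sub>M borel"
  by (simp add: measurable_cong_sets[OF sets_sphere_measure refl] measurable_restrict_space1)

lemma measurable_ray_projection:
  "(\<lambda>x::'a::euclidean_space. x /\<^sub>R norm x) \<in>
     restrict_space lborel (ball 0 1 - {0}) \<rightarrow>\<^sub>M restrict_space borel (sphere 0 1)"
  by (intro measurable_restrict_space2 measurable_restrict_space1)
     (auto simp: space_restrict_space)

text \<open>Once surface integrals are Lebesgue integrals over the ball of functions constant along
  rays, the polar formula is accessible to Fubini and linear substitutions.\<close>

lemma nn_integral_sphere_measure:
  fixes u :: "'a::euclidean_space \<Rightarrow> ennreal"
  assumes [measurable]: "u \<in> borel_measurable borel"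
  shows "(\<integral>\<^sup>+\<theta>. u \<theta> \<partial>sphere_measure) =
    (\<integral>\<^sup>+x. u (x /\<^sub>R norm x) * ennreal (real DIM('a) * indicator (ball 0 1 - {0}) x) \<partial>lborel)"
proof -
  have [measurable]: "ball 0 1 - {0 :: 'a} \<in> sets borel"
    by auto
  have "(\<integral>\<^sup>+\<theta>. u \<theta> \<partial>sphere_measure) = of_nat DIM('a) *
      (\<integral>\<^sup>+\<theta>. u \<theta> \<partial>distr (restrict_space lborel (ball 0 1 - {0})) (restrict_space borel (sphere 0 1))
         (\<lambda>x. x /\<^sub>R norm x))"
    unfolding sphere_measure_def
    by (rule nn_integral_scale_measure) (simp add: measurable_restrict_space1)
  also have "\<dots> = of_nat DIM('a) * (\<integral>\<^sup>+x. u (x /\<^sub>R norm x) \<partial>restrict_space lborel (ball 0 1 - {0}))"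
    by (subst nn_integral_distr[OF measurable_ray_projection]) (auto simp: measurable_restrict_space1)
  also have "\<dots> = of_nat DIM('a) * (\<integral>\<^sup>+x. u (x /\<^sub>R norm x) * indicator (ball 0 1 - {0}) x \<partial>lborel)"
    by (subst nn_integral_restrict_space) auto
  also have "\<dots> = (\<integral>\<^sup>+x. of_nat DIM('a) * (u (x /\<^sub>R norm x) * indicator (ball 0 1 - {0}) x) \<partial>lborel)"
    by (rule nn_integral_cmult[symmetric]) simp
  also have "\<dots> = (\<integral>\<^sup>+x. u (x /\<^sub>R norm x) * ennreal (real DIM('a) * indicator (ball 0 1 - {0}) x) \<partial>lborel)"
    by (intro nn_integral_cong) (auto simp: indicator_def ennreal_of_nat_eq_real_of_nat mult.commute)
  finally show ?thesis .
qed

lemma finite_measure_sphere_measure: "finite_measure (sphere_measure :: 'a::euclidean_space measure)"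
proof
  let ?B = "ball 0 1 - {0} :: 'a set"
  have "emeasure sphere_measure (space sphere_measure :: 'a set) = (\<integral>\<^sup>+(\<theta>::'a). 1 \<partial>sphere_measure)"
    by simp
  also have "\<dots> = (\<integral>\<^sup>+x. ennreal (real DIM('a)) * indicator ?B x \<partial>lborel)"
    by (subst nn_integral_sphere_measure) (auto intro!: nn_integral_cong simp: indicator_def)
  also have "\<dots> = ennreal (real DIM('a)) * emeasure lborel ?B"
    by (subst nn_integral_cmult_indicator) auto
  also have "\<dots> < \<infinity>"
    using emeasure_mono[of ?B "ball 0 1" lborel] emeasure_lborel_ball_finite[of "0::'a" 1]
    by (auto simp: ennreal_mult_eq_top_iff less_top[symmetric] top_unique)
  finally show "emeasure sphere_measure (space sphere_measure :: 'a set) \<noteq> \<infinity>"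
    by simp
qed

lemma nn_integral_lborel_scale:
  fixes g :: "'a::euclidean_space \<Rightarrow> ennreal"
  assumes [measurable]: "g \<in> borel_measurable borel" and c: "c > 0"
  shows "(\<integral>\<^sup>+x. g x \<partial>lborel) = (\<integral>\<^sup>+x. g (c *\<^sub>R x) * ennreal (c ^ DIM('a)) \<partial>lborel)"
proof -
  have "(\<integral>\<^sup>+x. g x \<partial>lborel) =
      (\<integral>\<^sup>+x. g x \<partial>density (distr lborel borel (\<lambda>x. 0 + c *\<^sub>R x)) (\<lambda>_. ennreal (\<bar>c\<bar> ^ DIM('a))))"
    using c by (intro arg_cong[where f = "\<lambda>M. integral\<^sup>N M g"] lborel_affine) simp
  also have "\<dots> = (\<integral>\<^sup>+x. ennreal (\<bar>c\<bar> ^ DIM('a)) * g x \<partial>distr lborel borel (\<lambda>x. 0 + c *\<^sub>R x))"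
    by (rule nn_integral_density) simp_all
  also have "\<dots> = (\<integral>\<^sup>+x. ennreal (\<bar>c\<bar> ^ DIM('a)) * g (0 + c *\<^sub>R x) \<partial>lborel)"
    by (rule nn_integral_distr) simp_all
  also have "\<dots> = (\<integral>\<^sup>+x. g (c *\<^sub>R x) * ennreal (c ^ DIM('a)) \<partial>lborel)"
    using c by (intro nn_integral_cong) (simp add: mult.commute)
  finally show ?thesis .
qed

text \<open>The antiderivative \<open>- (a ^ n / \<rho> ^ n)\<close> is -1 at a and tends to 0 at
  infinity.\<close>

lemma nn_integral_inverse_power:
  fixes a :: real
  assumes a: "a > 0" and n: "n > 0"
  shows "(\<integral>\<^sup>+\<rho>. ennreal (real n * a ^ n / \<rho> ^ Suc n * indicator {a<..} \<rho>) \<partial>lborel) = 1"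
proof -
  let ?f = "\<lambda>\<rho>. real n * a ^ n / \<rho> ^ Suc n"
  have "(\<integral>\<^sup>+\<rho>. ennreal (?f \<rho>) * indicator {a..} \<rho> \<partial>lborel) = ennreal (0 - (- (a ^ n / a ^ n)))"
  proof (rule nn_integral_FTC_atLeast[where F = "\<lambda>\<rho>. - (a ^ n / \<rho> ^ n)"])
    show "((\<lambda>\<rho>. - (a ^ n / \<rho> ^ n)) has_real_derivative ?f \<rho>) (at \<rho>)" if "a \<le> \<rho>" for \<rho>
    proof -
      obtain m where m: "n = Suc m"
        using n by (cases n) auto
      have "((\<lambda>\<rho>. - (a ^ n / \<rho> ^ n)) has_real_derivative
          - ((0 * \<rho> ^ n - a ^ n * (real n * \<rho> ^ (n - 1))) / (\<rho> ^ n * \<rho> ^ n))) (at \<rho>)"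
        using that a by (auto intro!: derivative_eq_intros)
      then show ?thesis
        using that a by (simp add: m mult_ac)
    qed
    show "0 \<le> ?f \<rho>" if "a \<le> \<rho>" for \<rho>
      using that a by simp
    show "((\<lambda>\<rho>. - (a ^ n / \<rho> ^ n)) \<longlongrightarrow> 0) at_top"
    proof -
      have "((\<lambda>\<rho>. a ^ n / \<rho> ^ n) \<longlongrightarrow> 0) at_top"
        by (intro tendsto_divide_0[OF tendsto_const] filterlim_at_top_imp_at_infinity
            filterlim_pow_at_top filterlim_ident n)
      then show ?thesis
        using tendsto_minus by fastforce
    qed
  qed auto
  moreover have "(\<integral>\<^sup>+\<rho>. ennreal (?f \<rho> * indicator {a<..} \<rho>) \<partial>lborel) =
      (\<integral>\<^sup>+\<rho>. ennreal (?f \<rho>) * indicator {a..} \<rho> \<partial>lborel)"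
    by (intro nn_integral_cong_AE, use AE_lborel_singleton[of a] in eventually_elim)
       (auto simp: indicator_def)
  ultimately show ?thesis
    using a by simp
qed

theorem nn_integral_polar:
  fixes F :: "'a::euclidean_space \<Rightarrow> ennreal"
  assumes [measurable]: "F \<in> borel_measurable borel"
  shows "(\<integral>\<^sup>+x. F x \<partial>lborel) =
    (\<integral>\<^sup>+r. (\<integral>\<^sup>+\<theta>. F (r *\<^sub>R \<theta>) \<partial>sphere_measure) * ennreal (r ^ (DIM('a) - 1) * indicator {0<..} r) \<partial>lborel)"
proof -
  let ?n = "DIM('a)"
  let ?B = "ball 0 1 - {0} :: 'a set"
  obtain m where m: "?n = Suc m"
    using DIM_positive[where 'a='a] by (metis Suc_pred)
  have [measurable]: "?B \<in> sets borel"
    by auto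
  txt \<open>After replacing the sphere by the unit ball, exchange the integrals, substitute \<open>r = |x| \<rho>\<close>,
    exchange again and substitute \<open>y = \<rho> x\<close>; what remains is
    \<open>\<integral> n |y|\<^sup>n \<rho>\<^bsup>-n-1\<^esup> d\<rho> = 1\<close> over \<open>\<rho> > |y|\<close>.\<close>
  define w1 where "w1 r x = real ?n * r ^ (?n - 1) * (if 0 < r \<and> 0 < norm x \<and> norm x < 1 then 1 else 0)" for r :: real and x :: 'a
  define w2 where "w2 r x = real ?n * norm x ^ ?n * r ^ (?n - 1) * (if 0 < r \<and> 0 < norm x \<and> norm x < 1 then 1 else 0)" for r :: real and x :: 'a
  define w3 where "w3 r x = real ?n * norm x ^ ?n / r ^ Suc ?n * (if norm x < r then 1 else 0)" for r :: real and x :: 'a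
  have [measurable]: "case_prod w1 \<in> borel_measurable (lborel \<Otimes>\<^sub>M lborel)" "\<And>r. w1 r \<in> borel_measurable borel"
    "\<And>x. (\<lambda>r. w1 r x) \<in> borel_measurable borel"
    unfolding w1_def split_beta' by measurable
  have [measurable]: "case_prod w2 \<in> borel_measurable (lborel \<Otimes>\<^sub>M lborel)" "\<And>r. w2 r \<in> borel_measurable borel"
    "\<And>x. (\<lambda>r. w2 r x) \<in> borel_measurable borel"
    unfolding w2_def split_beta' by measurable
  have [measurable]: "case_prod w3 \<in> borel_measurable (lborel \<Otimes>\<^sub>M lborel)" "\<And>r. w3 r \<in> borel_measurable borel"
    "\<And>x. (\<lambda>r. w3 r x) \<in> borel_measurable borel"
    unfolding w3_def split_beta' by measurable
  have "(\<integral>\<^sup>+r. (\<integral>\<^sup>+\<theta>. F (r *\<^sub>R \<theta>) \<partial>sphere_measure) * ennreal (r ^ (?n - 1) * indicator {0<..} r) \<partial>lborel)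
      = (\<integral>\<^sup>+r. (\<integral>\<^sup>+x. F (r *\<^sub>R (x /\<^sub>R norm x)) * ennreal (w1 r x) \<partial>lborel) \<partial>lborel)"
  proof (rule nn_integral_cong)
    fix r :: real
    have "(\<integral>\<^sup>+\<theta>. F (r *\<^sub>R \<theta>) \<partial>sphere_measure) * ennreal (r ^ (?n - 1) * indicator {0<..} r) =
       (\<integral>\<^sup>+x. F (r *\<^sub>R (x /\<^sub>R norm x)) * ennreal (real ?n * indicator ?B x)
          * ennreal (r ^ (?n - 1) * indicator {0<..} r) \<partial>lborel)"
      by (simp add: nn_integral_sphere_measure nn_integral_multc)
    also have "\<dots> = (\<integral>\<^sup>+x. F (r *\<^sub>R (x /\<^sub>R norm x)) * ennreal (w1 r x) \<partial>lborel)"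
      by (intro nn_integral_cong) (auto simp: w1_def indicator_def mult.assoc simp flip: ennreal_mult')
    finally show "(\<integral>\<^sup>+\<theta>. F (r *\<^sub>R \<theta>) \<partial>sphere_measure) * ennreal (r ^ (?n - 1) * indicator {0<..} r)
      = (\<integral>\<^sup>+x. F (r *\<^sub>R (x /\<^sub>R norm x)) * ennreal (w1 r x) \<partial>lborel)" .
  qed
  also have "\<dots> = (\<integral>\<^sup>+x. (\<integral>\<^sup>+r. F (r *\<^sub>R (x /\<^sub>R norm x)) * ennreal (w1 r x) \<partial>lborel) \<partial>lborel)"
    by (rule lborel_pair.Fubini') (simp add: split_beta', measurable)
  also have "\<dots> = (\<integral>\<^sup>+x. (\<integral>\<^sup>+r. F (r *\<^sub>R x) * ennreal (w2 r x) \<partial>lborel) \<partial>lborel)"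
  proof (rule nn_integral_cong)
    fix x :: 'a
    show "(\<integral>\<^sup>+r. F (r *\<^sub>R (x /\<^sub>R norm x)) * ennreal (w1 r x) \<partial>lborel) = (\<integral>\<^sup>+r. F (r *\<^sub>R x) * ennreal (w2 r x) \<partial>lborel)"
    proof (cases "x = 0")
      case True
      then show ?thesis by (simp add: w1_def w2_def)
    next
      case False
      have "(\<integral>\<^sup>+r. F (r *\<^sub>R (x /\<^sub>R norm x)) * ennreal (w1 r x) \<partial>lborel) =
          ennreal \<bar>norm x\<bar> * (\<integral>\<^sup>+r. F ((0 + norm x * r) *\<^sub>R (x /\<^sub>R norm x)) * ennreal (w1 (0 + norm x * r) x) \<partial>lborel)"
        using False by (intro nn_integral_real_affine) auto
      also have "\<dots> = (\<integral>\<^sup>+r. ennreal \<bar>norm x\<bar> * (F ((0 + norm x * r) *\<^sub>R (x /\<^sub>R norm x)) * ennreal (w1 (0 + norm x * r) x)) \<partial>lborel)"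
        by (rule nn_integral_cmult[symmetric]) simp
      also have "\<dots> = (\<integral>\<^sup>+r. F (r *\<^sub>R x) * ennreal (w2 r x) \<partial>lborel)"
      proof (rule nn_integral_cong)
        fix r :: real
        \<comment> \<open>The Jacobian |x| and the factor |x|^(n-1) from the power of r combine to
          the |x|^n in \<open>w2\<close>.\<close>
        have "norm x * w1 (norm x * r) x = w2 r x"
          using False by (simp add: w1_def w2_def m power_mult_distrib zero_less_mult_iff)
        then have "ennreal \<bar>norm x\<bar> * ennreal (w1 (norm x * r) x) = ennreal (w2 r x)"
          by (simp flip: ennreal_mult')
        moreover have "(norm x * r) *\<^sub>R (x /\<^sub>R norm x) = r *\<^sub>R x"
          using False by simp
        ultimately show "ennreal \<bar>norm x\<bar> * (F ((0 + norm x * r) *\<^sub>R (x /\<^sub>R norm x)) * ennreal (w1 (0 + norm x * r) x)) = F (r *\<^sub>R x) * ennreal (w2 r x)"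
          by (metis add_0 mult.left_commute)
      qed
      finally show ?thesis .
    qed
  qed
  also have "\<dots> = (\<integral>\<^sup>+r. (\<integral>\<^sup>+x. F (r *\<^sub>R x) * ennreal (w2 r x) \<partial>lborel) \<partial>lborel)"
    by (rule lborel_pair.Fubini'[symmetric]) (simp add: split_beta', measurable)
  also have "\<dots> = (\<integral>\<^sup>+r. (\<integral>\<^sup>+x. F x * ennreal (w3 r x) * indicator {y. y \<noteq> 0} x \<partial>lborel) \<partial>lborel)"
  proof (rule nn_integral_cong)
    fix r :: real
    show "(\<integral>\<^sup>+x. F (r *\<^sub>R x) * ennreal (w2 r x) \<partial>lborel) = (\<integral>\<^sup>+x. F x * ennreal (w3 r x) * indicator {y. y \<noteq> 0} x \<partial>lborel)"
    proof (cases "r > 0")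
      case False
      \<comment> \<open>A nonpositive r never exceeds a norm, so \<open>w3\<close> vanishes there
        without an explicit sign condition.\<close>
      then have "w2 r x = 0" "w3 r x = 0" for x
        using order_trans[OF norm_ge_zero[of x] less_imp_le, of r] by (auto simp: w2_def w3_def)
      then show ?thesis by simp
    next
      case True
      have "(\<integral>\<^sup>+x. F x * ennreal (w3 r x) * indicator {y. y \<noteq> 0} x \<partial>lborel) =
        (\<integral>\<^sup>+x. F (r *\<^sub>R x) * ennreal (w3 r (r *\<^sub>R x)) * indicator {y. y \<noteq> 0} (r *\<^sub>R x) * ennreal (r ^ ?n) \<partial>lborel)"
        using True by (intro nn_integral_lborel_scale) auto
      also have "\<dots> = (\<integral>\<^sup>+x. F (r *\<^sub>R x) * ennreal (w2 r x) \<partial>lborel)"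
      proof (rule nn_integral_cong)
        fix x :: 'a
        \<comment> \<open>By homogeneity the powers of r leave r^(n-1), and |rx| < r is the
          condition |x| < 1. The origin is excluded because \<open>w2\<close> vanishes there by its
          indicator while \<open>w3\<close> is guarded separately.\<close>
        have "w3 r (r *\<^sub>R x) * r ^ ?n = w2 r x" if "x \<noteq> 0"
          using True that by (simp add: w3_def w2_def m indicator_def power_mult_distrib field_simps)
        moreover have "w2 r 0 = 0"
          by (simp add: w2_def)
        ultimately show "F (r *\<^sub>R x) * ennreal (w3 r (r *\<^sub>R x)) * indicator {y. y \<noteq> 0} (r *\<^sub>R x) * ennreal (r ^ ?n) = F (r *\<^sub>R x) * ennreal (w2 r x)"
          using True by (cases "x = 0") (auto simp: mult.assoc simp flip: ennreal_mult'')
      qed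
      finally show ?thesis ..
    qed
  qed
  also have "\<dots> = (\<integral>\<^sup>+x. (\<integral>\<^sup>+r. F x * ennreal (w3 r x) * indicator {y. y \<noteq> 0} x \<partial>lborel) \<partial>lborel)"
    by (rule lborel_pair.Fubini') (simp add: split_beta', measurable)
  also have "\<dots> = (\<integral>\<^sup>+x. F x \<partial>lborel)"
  \<comment> \<open>The origin is dropped as a null set: the remaining radial integral starts at |x|
    and needs |x| > 0.\<close>
  proof (intro nn_integral_cong_AE, use AE_lborel_singleton[of 0] in eventually_elim)
    fix x :: 'a assume x: "x \<noteq> 0"
    then have "(\<integral>\<^sup>+r. F x * ennreal (w3 r x) * indicator {y. y \<noteq> 0} x \<partial>lborel) = F x * (\<integral>\<^sup>+r. ennreal (w3 r x) \<partial>lborel)"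
      by (simp add: nn_integral_cmult)
    also have "(\<integral>\<^sup>+r. ennreal (w3 r x) \<partial>lborel) = 1"
      unfolding w3_def using x nn_integral_inverse_power[of "norm x" ?n]
      by (simp add: indicator_def of_bool_def)
    finally show "(\<integral>\<^sup>+r. F x * ennreal (w3 r x) * indicator {y. y \<noteq> 0} x \<partial>lborel) = F x"
      by simp
  qed
  finally show ?thesis ..
qed

text \<open>A bound and a bounded support make the volume integral finite, and the sphere has finite
  measure, so the extended-real polar formula passes to Bochner integrals. The integrability claims
  are stated because functions of varying sign are handled by subtraction.\<close>

lemma integral_polar_nonneg:
  fixes F :: "'a::euclidean_space \<Rightarrow> real"
  assumes [measurable]: "F \<in> borel_measurable borel"
    and nonneg: "\<And>x. 0 \<le> F x" and le: "\<And>x. F x \<le> C" and supp: "\<And>x. F x \<noteq> 0 \<Longrightarrow> norm x \<le> c"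
  shows "integrable lborel F"
    and "integrable sphere_measure (\<lambda>\<theta>. F (r *\<^sub>R \<theta>))"
    and "set_integrable lborel {0<..} (\<lambda>r. (LINT \<theta>|sphere_measure. F (r *\<^sub>R \<theta>)) * r ^ (DIM('a) - 1))"
    and "(LINT x|lborel. F x) = (LINT r:{0<..}|lborel. (LINT \<theta>|sphere_measure. F (r *\<^sub>R \<theta>)) * r ^ (DIM('a) - 1))"
proof -
  interpret S: finite_measure "sphere_measure :: 'a measure"
    by (rule finite_measure_sphere_measure)
  have C: "0 \<le> C" using nonneg le order_trans by blast
  show F: "integrable lborel F"
  proof (rule Bochner_Integration.integrable_bound)
    show "integrable lborel (\<lambda>x::'a. C * indicator (cball 0 c) x)"
      by (intro integrable_mult_right integrable_real_indicator emeasure_lborel_cball_finite) simp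
    show "AE x in lborel. norm (F x) \<le> norm (C * indicator (cball 0 c) x)"
    proof (rule AE_I2)
      show "norm (F x) \<le> norm (C * indicator (cball 0 c) x)" for x
        using nonneg[of x] le[of x] supp[of x] C by (cases "F x = 0") (auto simp: indicator_def)
    qed
  qed simp
  show sph: "integrable sphere_measure (\<lambda>\<theta>. F (r *\<^sub>R \<theta>))" for r
    by (rule S.integrable_const_bound[where B = C]) (use nonneg le in auto)
  have inner: "(\<integral>\<^sup>+\<theta>. ennreal (F (r *\<^sub>R \<theta>)) \<partial>sphere_measure) = ennreal (LINT \<theta>|sphere_measure. F (r *\<^sub>R \<theta>))" for r
    by (rule nn_integral_eq_integral[OF sph]) (simp add: nonneg)
  let ?g = "\<lambda>r. indicator {0<..} r *\<^sub>R ((LINT \<theta>|sphere_measure. F (r *\<^sub>R \<theta>)) * r ^ (DIM('a) - 1))"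
  have "(\<lambda>r. LINT \<theta>|sphere_measure. F (r *\<^sub>R \<theta>)) \<in> borel_measurable borel"
    by (rule S.borel_measurable_lebesgue_integral) (simp add: split_beta', measurable)
  then have g[measurable]: "?g \<in> borel_measurable borel"
    by simp
  have gn: "?g r \<ge> 0" for r
    using nonneg by (auto simp: indicator_def)
  have eq: "(\<integral>\<^sup>+r. ennreal (?g r) \<partial>lborel) = (\<integral>\<^sup>+x. ennreal (F x) \<partial>lborel)"
    by (subst nn_integral_polar, simp, rule nn_integral_cong)
       (auto simp: inner indicator_def ennreal_mult nonneg)
  also have "\<dots> = ennreal (LINT x|lborel. F x)"
    by (rule nn_integral_eq_integral[OF F]) (simp add: nonneg)
  finally have eq': "(\<integral>\<^sup>+r. ennreal (?g r) \<partial>lborel) = ennreal (LINT x|lborel. F x)" .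
  have "integrable lborel ?g"
    by (rule integrableI_nonneg) (use gn eq' in auto)
  then show "set_integrable lborel {0<..} (\<lambda>r. (LINT \<theta>|sphere_measure. F (r *\<^sub>R \<theta>)) * r ^ (DIM('a) - 1))"
    by (simp add: set_integrable_def)
  have "(LINT r|lborel. ?g r) = (LINT x|lborel. F x)"
    by (subst integral_eq_nn_integral) (use gn eq' nonneg in \<open>auto\<close>)
  then show "(LINT x|lborel. F x) = (LINT r:{0<..}|lborel. (LINT \<theta>|sphere_measure. F (r *\<^sub>R \<theta>)) * r ^ (DIM('a) - 1))"
    by (simp add: set_lebesgue_integral_def)
qed

text \<open>Positive and negative parts are bounded with bounded support again, and both the sphere
  integrals and the radial integrals may be subtracted.\<close>

theorem integral_polar:
  fixes F :: "'a::euclidean_space \<Rightarrow> real"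
  assumes [measurable]: "F \<in> borel_measurable borel"
    and le: "\<And>x. \<bar>F x\<bar> \<le> C" and supp: "\<And>x. F x \<noteq> 0 \<Longrightarrow> norm x \<le> c"
  shows "(LINT x|lborel. F x) = polar_integral (\<lambda>r \<theta>. F (r *\<^sub>R \<theta>))"
proof -
  let ?p = "\<lambda>x. max 0 (F x)" and ?m = "\<lambda>x. max 0 (- F x)"
  have C: "0 \<le> C" using le abs_ge_zero order_trans by blast
  have p: "?p \<in> borel_measurable borel" "\<And>x. 0 \<le> ?p x" "\<And>x. ?p x \<le> C" "\<And>x. ?p x \<noteq> 0 \<Longrightarrow> norm x \<le> c"
   and m: "?m \<in> borel_measurable borel" "\<And>x. 0 \<le> ?m x" "\<And>x. ?m x \<le> C" "\<And>x. ?m x \<noteq> 0 \<Longrightarrow> norm x \<le> c"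
    using le supp C by (auto simp: abs_le_iff max_def split: if_splits)
  note P = integral_polar_nonneg[of ?p, OF p] and M = integral_polar_nonneg[of ?m, OF m]
  have pm: "F x = ?p x - ?m x" for x
    by auto
  have "(LINT x|lborel. F x) = (LINT x|lborel. ?p x - ?m x)"
    using pm by simp
  also have "\<dots> = (LINT x|lborel. ?p x) - (LINT x|lborel. ?m x)"
    by (intro Bochner_Integration.integral_diff P(1) M(1))
  also have "\<dots> = (LINT r:{0<..}|lborel. (LINT \<theta>|sphere_measure. ?p (r *\<^sub>R \<theta>)) * r ^ (DIM('a) - 1)
      - (LINT \<theta>|sphere_measure. ?m (r *\<^sub>R \<theta>)) * r ^ (DIM('a) - 1))"
    using P(4) M(4) set_integral_diff(2)[OF P(3) M(3)] by simp
  also have "\<dots> = polar_integral (\<lambda>r \<theta>. F (r *\<^sub>R \<theta>))"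
  proof -
    have "(LINT \<theta>|sphere_measure. F (r *\<^sub>R \<theta>)) =
        (LINT \<theta>|sphere_measure. ?p (r *\<^sub>R \<theta>)) - (LINT \<theta>|sphere_measure. ?m (r *\<^sub>R \<theta>))" for r
      using Bochner_Integration.integral_diff[OF P(2) M(2), of r r] pm by simp
    then show ?thesis
      by (simp add: polar_integral_def left_diff_distrib)
  qed
  finally show ?thesis .
qed

subsection \<open>The Euler operator and the spherical Laplacian\<close>

text \<open>Expanding x in the basis shows that E differentiates along x itself; this connects the
  coordinate sum with radial derivatives and with the chain rule for ray pullbacks.\<close>

lemma x_dot_grad_eq_frechet:
  assumes "f differentiable at x"
  shows "x_dot_grad f x = frechet_derivative f (at x) x"
proof -
  interpret linear "frechet_derivative f (at x)"
    by (rule linear_frechet_derivative[OF assms])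
  have "frechet_derivative f (at x) (\<Sum>b\<in>Basis. (x \<bullet> b) *\<^sub>R b) =
      (\<Sum>b\<in>Basis. (x \<bullet> b) *\<^sub>R frechet_derivative f (at x) b)"
    by (simp add: sum scale)
  then show ?thesis
    by (simp add: euclidean_representation x_dot_grad_def partial_deriv_def scaleR_conv_of_real)
qed

lemma x_dot_grad_add:
  assumes "f differentiable at x" "g differentiable at x"
  shows "x_dot_grad (\<lambda>x. f x + g x) x = x_dot_grad f x + x_dot_grad g x"
  unfolding x_dot_grad_def
  by (simp add: partial_deriv_add[OF assms] distrib_left sum.distrib)

lemma x_dot_grad_mult:
  assumes "f differentiable at x" "g differentiable at x"
  shows "x_dot_grad (\<lambda>x. f x * g x) x = f x * x_dot_grad g x + x_dot_grad f x * g x"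
  unfolding x_dot_grad_def
  by (simp add: partial_deriv_mult[OF assms] sum_distrib_left sum_distrib_right algebra_simps
      flip: sum.distrib)

lemma x_dot_grad_const [simp]: "x_dot_grad (\<lambda>x. c) x = 0"
  by (simp add: x_dot_grad_def)

lemma x_dot_grad_cmult:
  assumes "f differentiable at x"
  shows "x_dot_grad (\<lambda>x. c * f x) x = c * x_dot_grad f x"
  using x_dot_grad_mult[OF differentiable_const assms, of c] by simp

lemma x_dot_grad_diff:
  assumes "f differentiable at x" "g differentiable at x"
  shows "x_dot_grad (\<lambda>x. f x - g x) x = x_dot_grad f x - x_dot_grad g x"
  using x_dot_grad_add[OF assms(1) differentiable_mult[OF differentiable_const assms(2)], of "-1"]
  using x_dot_grad_cmult[OF assms(2), of "-1"] by simp

lemma x_dot_grad_cnj: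
  assumes "f differentiable at x"
  shows "x_dot_grad (\<lambda>x. cnj (f x)) x = cnj (x_dot_grad f x)"
  unfolding x_dot_grad_def by (simp add: partial_deriv_cnj[OF assms])

lemma x_dot_grad_sum:
  assumes "\<And>i. i \<in> I \<Longrightarrow> f i differentiable at x"
  shows "x_dot_grad (\<lambda>x. \<Sum>i\<in>I. f i x) x = (\<Sum>i\<in>I. x_dot_grad (f i) x)"
proof -
  have "x_dot_grad (\<lambda>x. \<Sum>i\<in>I. f i x) x = (\<Sum>b\<in>Basis. \<Sum>i\<in>I. of_real (x \<bullet> b) * partial_deriv b (f i) x)"
    unfolding x_dot_grad_def by (simp add: partial_deriv_sum[OF assms] sum_distrib_left)
  also have "\<dots> = (\<Sum>i\<in>I. x_dot_grad (f i) x)"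
    unfolding x_dot_grad_def by (rule sum.swap)
  finally show ?thesis .
qed

lemma x_dot_grad_inner_self: "x_dot_grad (\<lambda>x. of_real (x \<bullet> x)) x = of_real (2 * (x \<bullet> x))"
proof -
  have "frechet_derivative (\<lambda>x. complex_of_real (x \<bullet> x)) (at x) x = of_real (2 * (x \<bullet> x))"
    unfolding frechet_derivative_at[OF has_derivative_of_real_inner_self, symmetric] ..
  then show ?thesis
    by (simp add: x_dot_grad_eq_frechet[OF differentiable_scalars(2)])
qed

text \<open>The commutator of a partial derivative with E is that partial derivative: the extra term
  comes from differentiating the coordinate x \<bullet> b, and the others match after exchanging
  mixed derivatives.\<close>

lemma partial_deriv_x_dot_grad:
  assumes f: "punctured_test_function f" and b: "b \<in> Basis"
  shows "partial_deriv b (x_dot_grad f) x = partial_deriv b f x + x_dot_grad (partial_deriv b f) x"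
proof -
  have diff: "partial_deriv c f differentiable at x" if "c \<in> Basis" for c
    by (intro test_function_differentiable test_function_partial_deriv f that)
  have "partial_deriv b (x_dot_grad f) x =
      (\<Sum>c\<in>Basis. partial_deriv b (\<lambda>x. of_real (x \<bullet> c) * partial_deriv c f x) x)"
    unfolding x_dot_grad_def[abs_def]
    by (rule partial_deriv_sum) (intro differentiable_mult differentiable_scalars diff)
  also have "\<dots> = (\<Sum>c\<in>Basis. of_real (x \<bullet> c) * partial_deriv c (partial_deriv b f) x
      + of_real (b \<bullet> c) * partial_deriv c f x)"
    by (intro sum.cong refl)
       (simp add: partial_deriv_mult differentiable_scalars diff partial_deriv_inner partial_deriv_commute[OF f b])
  also have "\<dots> = x_dot_grad (partial_deriv b f) x + (\<Sum>c\<in>Basis. of_real (b \<bullet> c) * partial_deriv c f x)"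
    by (simp add: sum.distrib x_dot_grad_def)
  also have "(\<Sum>c\<in>Basis. of_real (b \<bullet> c) * partial_deriv c f x) =
      (\<Sum>c\<in>Basis. if c = b then partial_deriv c f x else 0)"
    using b by (intro sum.cong refl) (auto simp: inner_Basis)
  also have "\<dots> = partial_deriv b f x"
    using b by simp
  finally show ?thesis by (simp add: add.commute)
qed

text \<open>Each of the two derivatives in direction b contributes one commutator term, whence the
  factor 2.\<close>

lemma laplacian_x_dot_grad:
  assumes f: "punctured_test_function f"
  shows "laplacian (x_dot_grad f) x = 2 * laplacian f x + x_dot_grad (laplacian f) x"
proof -
  note tf = test_function_partial_deriv
  have "laplacian (x_dot_grad f) x =
      (\<Sum>b\<in>Basis. 2 * partial_deriv b (partial_deriv b f) x + x_dot_grad (partial_deriv b (partial_deriv b f)) x)"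
    unfolding laplacian_def
  proof (intro sum.cong refl)
    fix b :: 'a assume b: "b \<in> Basis"
    have "partial_deriv b (x_dot_grad f) = (\<lambda>x. partial_deriv b f x + x_dot_grad (partial_deriv b f) x)"
      using partial_deriv_x_dot_grad[OF f b] by blast
    then show "partial_deriv b (partial_deriv b (x_dot_grad f)) x =
        2 * partial_deriv b (partial_deriv b f) x + x_dot_grad (partial_deriv b (partial_deriv b f)) x"
      by (simp add: partial_deriv_add test_function_differentiable test_function_x_dot_grad tf f b
          partial_deriv_x_dot_grad)
  qed
  also have "\<dots> = 2 * laplacian f x + x_dot_grad (laplacian f) x"
    unfolding laplacian_def[abs_def] using f
    by (subst x_dot_grad_sum)
       (auto simp: sum.distrib sum_distrib_left intro!: test_function_differentiable tf)
  finally show ?thesis .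
qed

text \<open>By \<open>laplacian_ray_pullback\<close> below, this is the Laplace-Beltrami operator acting on each
  sphere about the origin.\<close>

definition spherical_laplacian :: "('a::euclidean_space \<Rightarrow> complex) \<Rightarrow> 'a \<Rightarrow> complex" where
  "spherical_laplacian f x = of_real (x \<bullet> x) * laplacian f x
     - x_dot_grad (x_dot_grad f) x - of_real (real DIM('a) - 2) * x_dot_grad f x"

lemma smooth_on_inner_self: "smooth_on S (\<lambda>x::'a::euclidean_space. of_real (x \<bullet> x))"
proof -
  have "smooth_upto k S (\<lambda>x::'a. of_real (x \<bullet> x))" for k
  proof (cases k)
    case (Suc k)
    have "smooth_upto k S (partial_deriv b (\<lambda>x. of_real (x \<bullet> x)))" for b :: 'a
    proof -
      have "partial_deriv b (\<lambda>x. of_real (x \<bullet> x)) = (\<lambda>x. of_real (x \<bullet> (2 *\<^sub>R b)))"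
        by (simp add: fun_eq_iff partial_deriv_inner_self)
      then show ?thesis by (simp only: smooth_upto_inner)
    qed
    with Suc show ?thesis by (simp add: differentiable_scalars)
  qed (simp add: differentiable_scalars)
  then show ?thesis by (simp add: smooth_on_iff_upto)
qed

lemma test_function_spherical_laplacian:
  assumes "punctured_test_function f"
  shows "punctured_test_function (spherical_laplacian f)"
  unfolding spherical_laplacian_def[abs_def] using assms
  by (intro test_function_diff test_function_mult smooth_on_inner_self smooth_on_const
      test_function_laplacian test_function_x_dot_grad)

text \<open>E applied to the factor |x|^2 yields 2 |x|^2, exactly the commutator term of
  \<open>laplacian_x_dot_grad\<close>; the rest of \<Lambda> is a polynomial in E.\<close>

lemma spherical_laplacian_x_dot_grad:
  assumes f: "punctured_test_function f"
  shows "spherical_laplacian (x_dot_grad f) x = x_dot_grad (spherical_laplacian f) x"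
proof -
  have d: "f differentiable at x" "laplacian f differentiable at x" "x_dot_grad f differentiable at x"
    "x_dot_grad (x_dot_grad f) differentiable at x"
    by (intro test_function_differentiable test_function_laplacian test_function_x_dot_grad f)+
  have d': "(\<lambda>x. of_real (x \<bullet> x) * laplacian f x) differentiable at x"
     "(\<lambda>x. of_real (real DIM('a) - 2) * x_dot_grad f x) differentiable at x"
    by (intro differentiable_mult differentiable_const differentiable_scalars d)+
  have "x_dot_grad (spherical_laplacian f) x =
      of_real (x \<bullet> x) * x_dot_grad (laplacian f) x + of_real (2 * (x \<bullet> x)) * laplacian f x
      - x_dot_grad (x_dot_grad (x_dot_grad f)) x - of_real (real DIM('a) - 2) * x_dot_grad (x_dot_grad f) x"
    unfolding spherical_laplacian_def[abs_def]
    by (simp add: x_dot_grad_diff x_dot_grad_cmult d d' differentiable_diff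
        x_dot_grad_mult[OF differentiable_scalars(2) d(2)] x_dot_grad_inner_self del: of_real_diff)
  then show ?thesis
    unfolding spherical_laplacian_def by (simp add: laplacian_x_dot_grad[OF f] algebra_simps)
qed

lemma spherical_laplacian_cmult:
  assumes f: "punctured_test_function f"
  shows "spherical_laplacian (\<lambda>x. c * f x) x = c * spherical_laplacian f x"
proof -
  note tf = test_function_partial_deriv test_function_differentiable test_function_x_dot_grad f
  have p: "partial_deriv b (\<lambda>x. c * g x) = (\<lambda>x. c * partial_deriv b g x)" if "punctured_test_function g" for b g
    by (auto simp: fun_eq_iff partial_deriv_mult tf that)
  have e: "x_dot_grad (\<lambda>x. c * g x) = (\<lambda>x. c * x_dot_grad g x)" if "punctured_test_function g" for g
    by (auto simp: fun_eq_iff x_dot_grad_cmult tf that)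
  have "laplacian (\<lambda>x. c * f x) x = c * laplacian f x"
    unfolding laplacian_def by (simp add: p tf sum_distrib_left)
  then show ?thesis
    by (simp add: spherical_laplacian_def e tf right_diff_distrib mult_ac)
qed

section \<open>Integration by parts with radial weights\<close>

lemma test_function_zero_at_0 [simp]: "punctured_test_function f \<Longrightarrow> f 0 = 0"
  by (metis norm_zero not_le test_function_support)

lemma sum_of_real_inner_square:
  "(\<Sum>b\<in>Basis. complex_of_real (x \<bullet> b) * of_real (x \<bullet> b)) = of_real ((norm x)\<^sup>2)"
proof -
  have "(norm x)\<^sup>2 = (\<Sum>b\<in>Basis. (x \<bullet> b) * (x \<bullet> b))"
    unfolding power2_norm_eq_inner by (rule euclidean_inner)
  then show ?thesis by simp
qed

lemma norm_powr_diff_two: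
  assumes "x \<noteq> 0"
  shows "of_real ((norm x)\<^sup>2) * of_real (norm x powr (s - 2)) = (of_real (norm x powr s) :: complex)"
proof -
  have "norm x powr s = (norm x)\<^sup>2 * norm x powr (s - 2)"
    using assms powr_add[of "norm x" 2 "s - 2"] by simp
  then show ?thesis by (simp flip: of_real_mult of_real_power)
qed

text \<open>The vector field |x|^s h(x) x has divergence |x|^s Eh + (n + s) |x|^s h: the coordinates
  contribute n, the weight contributes s. The integral of a divergence vanishes.\<close>

lemma integral_x_dot_grad:
  fixes h :: "'a::euclidean_space \<Rightarrow> complex"
  assumes h: "punctured_test_function h"
  shows "(LINT x|lborel. of_real (norm x powr s) * x_dot_grad h x) =
     - of_real (real DIM('a) + s) * (LINT x|lborel. of_real (norm x powr s) * h x)"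
proof -
  define g where "g b x = (of_real (x \<bullet> b) * of_real (norm x powr s)) * h x" for b x
  have g: "punctured_test_function (g b)" for b
    unfolding g_def by (intro test_function_mult smooth_on_mult smooth_on_scalars h) simp
  have tfs: "punctured_test_function (\<lambda>x. of_real (norm x powr s) * x_dot_grad h x)"
     "punctured_test_function (\<lambda>x. of_real (norm x powr s) * h x)"
    by (intro test_function_mult smooth_on_scalars test_function_x_dot_grad h)+
  have eq: "(\<Sum>b\<in>Basis. partial_deriv b (g b) x) =
      of_real (norm x powr s) * x_dot_grad h x + of_real (real DIM('a) + s) * (of_real (norm x powr s) * h x)" for x
  \<comment> \<open>The derivative formula for the weight is available off the origin only; at 0
    every term vanishes together with the test functions.\<close>
  proof (cases "x = 0")
    case True
    have "partial_deriv b (g b) 0 = 0" if "b \<in> Basis" for b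
      by (intro test_function_zero_at_0 test_function_partial_deriv g that)
    with True h show ?thesis
      by (simp add: test_function_x_dot_grad test_function_laplacian)
  next
    case False
    have "partial_deriv b (g b) x = of_real (norm x powr s) * (of_real (x \<bullet> b) * partial_deriv b h x)
        + (of_real (x \<bullet> b) * of_real (x \<bullet> b)) * (of_real s * of_real (norm x powr (s - 2)) * h x)
        + of_real (norm x powr s) * h x" if b: "b \<in> Basis" for b
      using False b unfolding g_def
      by (simp add: partial_deriv_mult differentiable_scalars test_function_differentiable h
          partial_deriv_inner partial_deriv_norm_powr differentiable_mult algebra_simps)
    then have "(\<Sum>b\<in>Basis. partial_deriv b (g b) x) = of_real (norm x powr s) * x_dot_grad h x
       + of_real ((norm x)\<^sup>2) * (of_real s * of_real (norm x powr (s - 2)) * h x)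
       + of_nat DIM('a) * (of_real (norm x powr s) * h x)"
      unfolding sum_of_real_inner_square[symmetric]
      by (simp add: sum.distrib x_dot_grad_def sum_distrib_left sum_distrib_right)
    also have "of_real ((norm x)\<^sup>2) * (of_real s * of_real (norm x powr (s - 2)) * h x)
        = of_real s * (of_real ((norm x)\<^sup>2) * of_real (norm x powr (s - 2))) * h x"
      by (simp only: mult_ac)
    also have "\<dots> = of_real s * of_real (norm x powr s) * h x"
      by (simp only: norm_powr_diff_two[OF False])
    finally show ?thesis by (simp add: algebra_simps)
  qed
  have "0 = (\<Sum>b\<in>Basis. LINT x|lborel. partial_deriv b (g b) x)"
    using integral_partial_deriv[OF g] by simp
  also have "\<dots> = (LINT x|lborel. (\<Sum>b\<in>Basis. partial_deriv b (g b) x))"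
    by (rule Bochner_Integration.integral_sum[symmetric]) (intro test_function_integrable test_function_partial_deriv g)
  also have "\<dots> = (LINT x|lborel. of_real (norm x powr s) * x_dot_grad h x)
     + of_real (real DIM('a) + s) * (LINT x|lborel. of_real (norm x powr s) * h x)"
    unfolding eq using tfs[THEN test_function_integrable] by simp
  finally show ?thesis
    unfolding mult_minus_left eq_neg_iff_add_eq_0 by (rule sym)
qed

text \<open>Green's identity for the field |x|^s conj(f) \<nabla>f, whose divergence has one term
  for each of the three factors. The integrability statement is needed when |Ef|^2 is later
  estimated by |x|^2 |\<nabla>f|^2 under the integral.\<close>

lemma integral_grad_norm:
  fixes f :: "'a::euclidean_space \<Rightarrow> complex"
  assumes f: "punctured_test_function f"
  shows "complex_of_real (LINT x|lborel. norm x powr s * (grad_norm f x)\<^sup>2) =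
     - (LINT x|lborel. of_real (norm x powr s) * (cnj (f x) * laplacian f x))
     - of_real s * (LINT x|lborel. of_real (norm x powr (s - 2)) * (cnj (f x) * x_dot_grad f x))"
    and "integrable lborel (\<lambda>x. norm x powr s * (grad_norm f x)\<^sup>2)"
proof -
  define g where "g b x = of_real (norm x powr s) * (cnj (f x) * partial_deriv b f x)" for b x
  have mult: "punctured_test_function (\<lambda>x. cnj (f x) * u x)" if "punctured_test_function u" for u
    by (intro test_function_mult that test_function_smooth[OF test_function_cnj] f)
  have g: "punctured_test_function (g b)" if "b \<in> Basis" for b
    unfolding g_def by (intro test_function_mult smooth_on_scalars mult test_function_partial_deriv f that)
  have tfs: "punctured_test_function (\<lambda>x. of_real (norm x powr s) * (cnj (f x) * laplacian f x))"
     "punctured_test_function (\<lambda>x. of_real (norm x powr (s - 2)) * (cnj (f x) * x_dot_grad f x))"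
    by (intro test_function_mult smooth_on_scalars mult test_function_x_dot_grad test_function_laplacian f)+
  have sq: "punctured_test_function (\<lambda>x. of_real (norm x powr s) * (\<Sum>b\<in>Basis. cnj (partial_deriv b f x) * partial_deriv b f x))"
    by (intro test_function_mult smooth_on_scalars test_function_sum test_function_smooth[OF test_function_cnj]
        test_function_partial_deriv f)
  have grad: "of_real (norm x powr s) * (\<Sum>b\<in>Basis. cnj (partial_deriv b f x) * partial_deriv b f x) =
     complex_of_real (norm x powr s * (grad_norm f x)\<^sup>2)" for x
    by (simp add: grad_norm_def sum_nonneg complex_norm_square mult.commute del: of_real_power)
  have int: "integrable lborel (\<lambda>x. complex_of_real (norm x powr s * (grad_norm f x)\<^sup>2))"
    using test_function_integrable[OF sq] unfolding grad .
  then show int': "integrable lborel (\<lambda>x. norm x powr s * (grad_norm f x)\<^sup>2)"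
    using complex_of_real_integrable_eq by blast
  have eq: "(\<Sum>b\<in>Basis. partial_deriv b (g b) x) =
      complex_of_real (norm x powr s * (grad_norm f x)\<^sup>2) + of_real (norm x powr s) * (cnj (f x) * laplacian f x)
      + of_real s * (of_real (norm x powr (s - 2)) * (cnj (f x) * x_dot_grad f x))" for x
  proof (cases "x = 0")
    case True
    have "partial_deriv b (g b) 0 = 0" if "b \<in> Basis" for b
      by (intro test_function_zero_at_0 test_function_partial_deriv g that)
    with True f show ?thesis
      by (simp add: test_function_x_dot_grad test_function_laplacian)
  next
    case False
    have "partial_deriv b (g b) x = of_real (norm x powr s) * (cnj (partial_deriv b f x) * partial_deriv b f x)
        + of_real (norm x powr s) * (cnj (f x) * partial_deriv b (partial_deriv b f) x)
        + of_real s * (of_real (norm x powr (s - 2)) * (cnj (f x) * (of_real (x \<bullet> b) * partial_deriv b f x)))" if b: "b \<in> Basis" for b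
      using False b unfolding g_def
      by (simp add: partial_deriv_mult differentiable_scalars test_function_differentiable test_function_partial_deriv f
          partial_deriv_cnj differentiable_cnj partial_deriv_norm_powr differentiable_mult algebra_simps)
    then show ?thesis
      unfolding grad[symmetric]
      by (simp add: sum.distrib x_dot_grad_def laplacian_def sum_distrib_left)
  qed
  have "0 = (\<Sum>b\<in>Basis. LINT x|lborel. partial_deriv b (g b) x)"
    using integral_partial_deriv[OF g] by simp
  also have "\<dots> = (LINT x|lborel. (\<Sum>b\<in>Basis. partial_deriv b (g b) x))"
    by (rule Bochner_Integration.integral_sum[symmetric]) (intro test_function_integrable test_function_partial_deriv g)
  also have "\<dots> = (LINT x|lborel. complex_of_real (norm x powr s * (grad_norm f x)\<^sup>2))
     + (LINT x|lborel. of_real (norm x powr s) * (cnj (f x) * laplacian f x))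
      + of_real s * (LINT x|lborel. of_real (norm x powr (s - 2)) * (cnj (f x) * x_dot_grad f x))"
    unfolding eq using tfs[THEN test_function_integrable] int by simp
  also have "(LINT x|lborel. complex_of_real (norm x powr s * (grad_norm f x)\<^sup>2)) = complex_of_real (LINT x|lborel. norm x powr s * (grad_norm f x)\<^sup>2)"
    by (rule integral_complex_of_real)
  finally have "0 = complex_of_real (LINT x|lborel. norm x powr s * (grad_norm f x)\<^sup>2)
     + (LINT x|lborel. of_real (norm x powr s) * (cnj (f x) * laplacian f x))
     + of_real s * (LINT x|lborel. of_real (norm x powr (s - 2)) * (cnj (f x) * x_dot_grad f x))" .
  moreover have "0 = a + b + c \<Longrightarrow> a = - b - c" for a b c :: complex
    by algebra
  ultimately show "complex_of_real (LINT x|lborel. norm x powr s * (grad_norm f x)\<^sup>2) =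
     - (LINT x|lborel. of_real (norm x powr s) * (cnj (f x) * laplacian f x))
     - of_real s * (LINT x|lborel. of_real (norm x powr (s - 2)) * (cnj (f x) * x_dot_grad f x))"
    by blast
qed

subsection \<open>Functions on spheres and the square root\<close>

text \<open>The ray extension of the slice of h at radius r, written as h composed with one map so
  that the chain rule applies.\<close>

definition ray_pullback :: "real \<Rightarrow> ('a::euclidean_space \<Rightarrow> complex) \<Rightarrow> 'a \<Rightarrow> complex" where
  "ray_pullback r h x = h ((r / norm x) *\<^sub>R x)"

lemma has_derivative_ray_pullback:
  fixes x :: "'a::euclidean_space"
  assumes h: "h differentiable at ((r / norm x) *\<^sub>R x)" and x: "x \<noteq> 0"
  shows "(ray_pullback r h has_derivative (\<lambda>k. frechet_derivative h (at ((r / norm x) *\<^sub>R x))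
     ((r / norm x) *\<^sub>R k - (r * (x \<bullet> k) / norm x ^ 3) *\<^sub>R x))) (at x)"
  unfolding ray_pullback_def[abs_def]
proof (rule has_derivative_compose[of "\<lambda>x. (r / norm x) *\<^sub>R x" _ x UNIV h])
  show "((\<lambda>x. (r / norm x) *\<^sub>R x) has_derivative
      (\<lambda>k. (r / norm x) *\<^sub>R k - (r * (x \<bullet> k) / norm x ^ 3) *\<^sub>R x)) (at x)"
  proof (rule has_derivative_eq_rhs)
    show "((\<lambda>x. (r / norm x) *\<^sub>R x) has_derivative
        (\<lambda>k. (r / norm x) *\<^sub>R k + ((0 * norm x - r * (k \<bullet> sgn x)) / (norm x * norm x)) *\<^sub>R x)) (at x)"
      by (intro has_derivative_scaleR has_derivative_divide' has_derivative_const has_derivative_norm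
          has_derivative_ident) (use x in auto)
    have "(0 * norm x - r * (k \<bullet> sgn x)) / (norm x * norm x) = - (r * (x \<bullet> k) / norm x ^ 3)" for k
      using x by (simp add: sgn_div_norm inner_commute power3_eq_cube divide_inverse)
    then show "(\<lambda>k. (r / norm x) *\<^sub>R k + ((0 * norm x - r * (k \<bullet> sgn x)) / (norm x * norm x)) *\<^sub>R x)
        = (\<lambda>k. (r / norm x) *\<^sub>R k - (r * (x \<bullet> k) / norm x ^ 3) *\<^sub>R x)"
      by (simp add: fun_eq_iff)
  qed
  show "(h has_derivative frechet_derivative h (at ((r / norm x) *\<^sub>R x))) (at ((r / norm x) *\<^sub>R x))"
    using h by (simp add: frechet_derivative_works)
qed

text \<open>The formula involves only pullbacks of test functions at the same radius, with
  coefficients smooth off the origin. This shape lets the smoothness induction close and allows the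
  formula to be applied a second time. The derivative along the radial correction is recognized as
  Eh at the rescaled point.\<close>

lemma partial_deriv_ray_pullback:
  fixes x :: "'a::euclidean_space"
  assumes h: "punctured_test_function h" and x: "x \<noteq> 0"
  shows "partial_deriv b (ray_pullback r h) x =
    (of_real r * of_real (norm x powr -1)) * ray_pullback r (partial_deriv b h) x
    + (of_real (-1) * (of_real (x \<bullet> b) * of_real (norm x powr -2))) * ray_pullback r (x_dot_grad h) x"
proof -
  let ?y = "(r / norm x) *\<^sub>R x"
  have d: "h differentiable at ?y"
    using h by (rule test_function_differentiable)
  interpret D: linear "frechet_derivative h (at ?y)"
    by (rule linear_frechet_derivative[OF d])
  have E: "x_dot_grad h ?y = (r / norm x) *\<^sub>R frechet_derivative h (at ?y) x"
    unfolding x_dot_grad_eq_frechet[OF d] by (rule D.scale)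
  have "partial_deriv b (ray_pullback r h) x =
      frechet_derivative h (at ?y) ((r / norm x) *\<^sub>R b - (r * (x \<bullet> b) / norm x ^ 3) *\<^sub>R x)"
    by (rule partial_deriv_eqI[OF has_derivative_ray_pullback[OF d x]])
  also have "\<dots> = (r / norm x) *\<^sub>R partial_deriv b h ?y
      - ((x \<bullet> b) / norm x ^ 2) *\<^sub>R ((r / norm x) *\<^sub>R frechet_derivative h (at ?y) x)"
    using x by (simp add: D.diff D.scale partial_deriv_def field_simps power3_eq_cube power2_eq_square)
  also have "\<dots> = (r / norm x) *\<^sub>R partial_deriv b h ?y - ((x \<bullet> b) / norm x ^ 2) *\<^sub>R x_dot_grad h ?y"
    unfolding E ..
  finally show ?thesis
    using x by (simp add: ray_pullback_def scaleR_conv_of_real powr_minus_divide divide_inverse)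
qed

lemma differentiable_ray_pullback:
  "punctured_test_function h \<Longrightarrow> x \<noteq> 0 \<Longrightarrow> ray_pullback r h differentiable at x"
  using has_derivative_ray_pullback test_function_differentiable differentiableI by blast

lemma smooth_on_ray_pullback:
  assumes "punctured_test_function h"
  shows "smooth_on (- {0}) (ray_pullback r h)"
proof -
  have "smooth_upto k (- {0}) (ray_pullback r h)" for k
    using assms
  proof (induction k arbitrary: h)
    case 0
    then show ?case by (simp add: differentiable_ray_pullback)
  next
    case (Suc k)
    have "smooth_upto k (- {0}) (partial_deriv b (ray_pullback r h))" if b: "b \<in> Basis" for b
    proof (rule smooth_upto_cong)
      show "(of_real r * of_real (norm x powr -1)) * ray_pullback r (partial_deriv b h) x
          + (of_real (-1) * (of_real (x \<bullet> b) * of_real (norm x powr -2))) * ray_pullback r (x_dot_grad h) x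
          = partial_deriv b (ray_pullback r h) x" if "x \<in> - {0}" for x
        using partial_deriv_ray_pullback[OF Suc.prems, of x b r] that by simp
      show "smooth_upto k (- {0}) (\<lambda>x. (of_real r * of_real (norm x powr -1)) * ray_pullback r (partial_deriv b h) x
          + (of_real (-1) * (of_real (x \<bullet> b) * of_real (norm x powr -2))) * ray_pullback r (x_dot_grad h) x)"
        by (intro smooth_upto_add smooth_upto_mult smooth_upto_const smooth_upto_norm_powr smooth_upto_inner
            Suc.IH test_function_partial_deriv test_function_x_dot_grad Suc.prems b open_punctured)
    qed simp
    then show ?case
      using Suc.prems by (simp add: differentiable_ray_pullback)
  qed
  then show ?thesis by (simp add: smooth_on_iff_upto)
qed

text \<open>At |\<theta>| = 1 the norm powers in the coefficients equal 1. Summation over the basis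
  turns the components of \<theta> into E or into |\<theta>|^2 = 1: two mixed terms -E^2 and one
  +E^2 leave -E^2, and the first-order terms 2 - n leave -(n - 2)E.\<close>

lemma laplacian_ray_pullback:
  fixes \<theta> :: "'a::euclidean_space"
  assumes h: "punctured_test_function h" and \<theta>: "norm \<theta> = 1"
  shows "laplacian (ray_pullback r h) \<theta> = spherical_laplacian h (r *\<^sub>R \<theta>)"
proof -
  let ?y = "r *\<^sub>R \<theta>"
  have \<theta>0: "\<theta> \<noteq> 0" using \<theta> by auto
  note tf = test_function_partial_deriv test_function_x_dot_grad h
  have pull: "ray_pullback r g \<theta> = g ?y" for g
    by (simp add: ray_pullback_def \<theta>)
  have pd: "partial_deriv b (ray_pullback r g) \<theta> = of_real r * partial_deriv b g ?y - of_real (\<theta> \<bullet> b) * x_dot_grad g ?y"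
    if "punctured_test_function g" for g b
    using partial_deriv_ray_pullback[OF that \<theta>0] by (simp add: pull \<theta>)
  have sq: "(\<Sum>b\<in>Basis. complex_of_real (\<theta> \<bullet> b) * of_real (\<theta> \<bullet> b)) = 1"
    using sum_of_real_inner_square[of \<theta>] \<theta> by simp
  have E: "(\<Sum>b\<in>Basis. of_real (\<theta> \<bullet> b) * (of_real r * partial_deriv b g ?y)) = x_dot_grad g ?y" for g
    unfolding x_dot_grad_def by (intro sum.cong refl) simp
  \<comment> \<open>The commutator relation merges E applied to the b-derivative of h with that
    derivative itself, so both mixed terms become b-derivatives of Eh and sum to E^2 h.\<close>
  have term_eq: "partial_deriv b (partial_deriv b (ray_pullback r h)) \<theta> =
      of_real (r\<^sup>2) * partial_deriv b (partial_deriv b h) ?y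
      - of_real (\<theta> \<bullet> b) * (of_real r * partial_deriv b (x_dot_grad h) ?y)
      - of_real (\<theta> \<bullet> b) * (of_real r * partial_deriv b (x_dot_grad h) ?y)
      + of_real (\<theta> \<bullet> b) * of_real (\<theta> \<bullet> b) * (x_dot_grad (x_dot_grad h) ?y + 2 * x_dot_grad h ?y)
      - x_dot_grad h ?y" if b: "b \<in> Basis" for b
  proof -
    define k :: complex where "k = of_real (-1)"
    define N1 N2 X :: "'a \<Rightarrow> complex" where
      "N1 x = of_real (norm x powr -1)" and "N2 x = of_real (norm x powr -2)" and "X x = of_real (x \<bullet> b)" for x
    have N: "N1 \<theta> = 1" "N2 \<theta> = 1" "X \<theta> = of_real (\<theta> \<bullet> b)"
      by (simp_all add: N1_def N2_def X_def \<theta>)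
    have D: "N1 differentiable at \<theta>" "N2 differentiable at \<theta>" "X differentiable at \<theta>"
      unfolding N1_def[abs_def] N2_def[abs_def] X_def[abs_def]
      by (rule differentiable_scalars \<theta>0)+
    have P: "partial_deriv b N1 \<theta> = - of_real (\<theta> \<bullet> b)" "partial_deriv b N2 \<theta> = - 2 * of_real (\<theta> \<bullet> b)"
      "partial_deriv b X \<theta> = 1"
      unfolding N1_def[abs_def] N2_def[abs_def] X_def[abs_def] partial_deriv_norm_powr[OF \<theta>0] partial_deriv_inner
      by (use \<theta> b in simp_all)
    have "partial_deriv b (partial_deriv b (ray_pullback r h)) \<theta> =
        partial_deriv b (\<lambda>x. (of_real r * N1 x) * ray_pullback r (partial_deriv b h) x
          + (k * (X x * N2 x)) * ray_pullback r (x_dot_grad h) x) \<theta>"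
      by (rule partial_deriv_cong[of "- {0}"])
         (use \<theta>0 h partial_deriv_ray_pullback in \<open>auto simp: N1_def N2_def X_def k_def\<close>)
    also have "\<dots> = of_real r * (of_real r * partial_deriv b (partial_deriv b h) ?y
        - of_real (\<theta> \<bullet> b) * x_dot_grad (partial_deriv b h) ?y)
        - of_real r * of_real (\<theta> \<bullet> b) * partial_deriv b h ?y
        - of_real (\<theta> \<bullet> b) * (of_real r * partial_deriv b (x_dot_grad h) ?y - of_real (\<theta> \<bullet> b) * x_dot_grad (x_dot_grad h) ?y)
        - (1 - 2 * of_real (\<theta> \<bullet> b) * of_real (\<theta> \<bullet> b)) * x_dot_grad h ?y"
      using b by (simp add: partial_deriv_add partial_deriv_mult differentiable_add differentiable_mult N D P
          differentiable_ray_pullback tf \<theta>0 pd pull, simp add: k_def algebra_simps)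
    finally show ?thesis
      by (simp add: partial_deriv_x_dot_grad[OF h b] algebra_simps power2_eq_square)
  qed
  have "laplacian (ray_pullback r h) \<theta> = of_real (r\<^sup>2) * laplacian h ?y - x_dot_grad (x_dot_grad h) ?y
      - x_dot_grad (x_dot_grad h) ?y + (x_dot_grad (x_dot_grad h) ?y + 2 * x_dot_grad h ?y)
      - of_nat DIM('a) * x_dot_grad h ?y"
    unfolding laplacian_def
    by (simp only: term_eq sum.distrib sum_subtractf E sq mult_1_left sum_constant
        flip: sum_distrib_left sum_distrib_right cong: sum.cong)
  moreover have "?y \<bullet> ?y = r\<^sup>2"
    using \<theta> by (simp add: power2_eq_square flip: power2_norm_eq_inner)
  ultimately show ?thesis
    by (simp add: spherical_laplacian_def algebra_simps)
qed

text \<open>Only the values of u on the unit sphere are prescribed: the ray extension sees nothing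
  else and agrees off the origin with the ray pullback. Hence slices of f and radial derivatives are
  covered alike.\<close>

lemma
  fixes u h :: "'a::euclidean_space \<Rightarrow> complex"
  assumes h: "punctured_test_function h" and u: "\<And>\<theta>. norm \<theta> = 1 \<Longrightarrow> u \<theta> = h (r *\<^sub>R \<theta>)"
  shows smooth_on_sphere_dilation: "smooth_on_sphere u"
    and laplace_beltrami_dilation: "norm \<theta> = 1 \<Longrightarrow> laplace_beltrami u \<theta> = spherical_laplacian h (r *\<^sub>R \<theta>)"
proof -
  have eq: "ray_pullback r h x = ray_extension u x" if "x \<in> - {0}" for x
    using that u[of "x /\<^sub>R norm x"] by (simp add: ray_pullback_def ray_extension_def divide_inverse)
  show "smooth_on_sphere u"
    unfolding smooth_on_sphere_def
    by (rule smooth_on_cong[OF open_punctured eq smooth_on_ray_pullback[OF h]])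
  show "laplace_beltrami u \<theta> = spherical_laplacian h (r *\<^sub>R \<theta>)" if \<theta>: "norm \<theta> = 1"
  proof -
    have \<theta>0: "\<theta> \<in> - {0}" using \<theta> by auto
    have "partial_deriv b (ray_extension u) x = partial_deriv b (ray_pullback r h) x" if "x \<in> - {0}" for b x
      by (rule partial_deriv_cong[OF open_punctured that]) (rule eq[symmetric])
    then have "partial_deriv b (partial_deriv b (ray_extension u)) \<theta> = partial_deriv b (partial_deriv b (ray_pullback r h)) \<theta>" for b
      by (rule partial_deriv_cong[OF open_punctured \<theta>0])
    then show ?thesis
      unfolding laplace_beltrami_def laplacian_ray_pullback[OF h \<theta>, symmetric] laplacian_def by simp
  qed
qed

lemma L2_fun_sphere_measure:
  assumes "punctured_test_function h" and "\<And>\<theta>. norm \<theta> = 1 \<Longrightarrow> u \<theta> = h (r *\<^sub>R \<theta>)"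
  shows "u \<in> L2_fun sphere_measure"
proof -
  interpret finite_measure "sphere_measure :: 'a measure"
    by (rule finite_measure_sphere_measure)
  obtain C where C: "\<And>x. cmod (h x) \<le> C"
    using bounded_test_function[OF assms(1)] by blast
  have [measurable]: "h \<in> borel_measurable borel"
    by (intro borel_measurable_continuous_onI test_function_continuous_on assms)
  have "(\<lambda>\<theta>. h (r *\<^sub>R \<theta>)) \<in> borel_measurable sphere_measure"
    by measurable
  then have u[measurable]: "u \<in> borel_measurable sphere_measure"
    by (rule measurable_cong[THEN iffD2, rotated]) (simp add: assms(2))
  have "integrable sphere_measure (\<lambda>\<theta>. (cmod (u \<theta>))\<^sup>2)"
  proof (rule integrable_const_bound)
    show "AE \<theta> in sphere_measure. norm ((cmod (u \<theta>))\<^sup>2) \<le> C\<^sup>2"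
      by (rule AE_I2) (use C assms(2) in \<open>simp add: power_mono\<close>)
  qed simp
  with u show ?thesis by (simp add: L2_fun_def)
qed

text \<open>The pair already belongs to the graph being closed and approximates itself at distance
  0; only square integrability has to be checked.\<close>

lemma neg_laplace_beltrami_op_dilation:
  assumes h: "punctured_test_function h" and u: "\<And>\<theta>. norm \<theta> = 1 \<Longrightarrow> u \<theta> = h (r *\<^sub>R \<theta>)"
  shows "(u, \<lambda>\<theta>. - laplace_beltrami u \<theta>) \<in> neg_laplace_beltrami_op"
proof -
  have "u \<in> L2_fun sphere_measure"
    using h u by (rule L2_fun_sphere_measure)
  moreover have "(\<lambda>\<theta>. - laplace_beltrami u \<theta>) \<in> L2_fun sphere_measure"
    using test_function_cmult[OF test_function_spherical_laplacian[OF h], of "-1"]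
    by (intro L2_fun_sphere_measure[of "\<lambda>x. - spherical_laplacian h x" _ r])
       (simp_all add: laplace_beltrami_dilation[OF h u])
  moreover have "\<exists>(p, q) \<in> {(u, \<lambda>\<theta>. - laplace_beltrami u \<theta>) | u. smooth_on_sphere u}.
      L2_dist sphere_measure p u < e \<and> L2_dist sphere_measure q (\<lambda>\<theta>. - laplace_beltrami u \<theta>) < e" if "e > 0" for e
    using smooth_on_sphere_dilation[OF h u] that
    by (intro bexI[of _ "(u, \<lambda>\<theta>. - laplace_beltrami u \<theta>)"]) (auto simp: L2_dist_def)
  ultimately show ?thesis
    by (simp add: neg_laplace_beltrami_op_def op_closure_def)
qed

section \<open>Square integrable functions\<close>

lemma L2_fun_diff:
  assumes "u \<in> L2_fun M" "v \<in> L2_fun M"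
  shows "(\<lambda>x. u x - v x) \<in> L2_fun M"
proof -
  have m[measurable]: "u \<in> borel_measurable M" "v \<in> borel_measurable M"
    using assms by (auto simp: L2_fun_def)
  have "integrable M (\<lambda>x. (cmod (u x - v x))\<^sup>2)"
  proof (rule Bochner_Integration.integrable_bound)
    show "integrable M (\<lambda>x. 2 * (cmod (u x))\<^sup>2 + 2 * (cmod (v x))\<^sup>2)"
      using assms by (auto simp: L2_fun_def)
    have "(cmod (a - b))\<^sup>2 \<le> 2 * (cmod a)\<^sup>2 + 2 * (cmod b)\<^sup>2" for a b
    proof -
      have "(cmod (a - b))\<^sup>2 \<le> (cmod a + cmod b)\<^sup>2"
        by (intro power_mono norm_triangle_ineq4) simp
      also have "\<dots> \<le> 2 * (cmod a)\<^sup>2 + 2 * (cmod b)\<^sup>2"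
        using sum_squares_bound[of "cmod a" "cmod b"] by (simp add: power2_sum)
      finally show ?thesis .
    qed
    then show "AE x in M. norm ((cmod (u x - v x))\<^sup>2) \<le> norm (2 * (cmod (u x))\<^sup>2 + 2 * (cmod (v x))\<^sup>2)"
      by (intro AE_I2) (simp add: abs_of_nonneg)
  qed simp
  then show ?thesis by (simp add: L2_fun_def)
qed

lemma L2_inner_integrable:
  assumes "u \<in> L2_fun M" "v \<in> L2_fun M"
  shows "integrable M (\<lambda>x. u x * cnj (v x))"
proof (rule Bochner_Integration.integrable_bound)
  show "integrable M (\<lambda>x. (cmod (u x))\<^sup>2 + (cmod (v x))\<^sup>2)"
    using assms by (auto simp: L2_fun_def)
  have "cmod a * cmod b \<le> (cmod a)\<^sup>2 + (cmod b)\<^sup>2" for a b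
    using sum_squares_bound[of "cmod a" "cmod b"] mult_nonneg_nonneg[OF norm_ge_zero[of a] norm_ge_zero[of b]]
    by linarith
  then show "AE x in M. norm (u x * cnj (v x)) \<le> norm ((cmod (u x))\<^sup>2 + (cmod (v x))\<^sup>2)"
    by (intro AE_I2) (simp add: norm_mult abs_of_nonneg)
  have [measurable]: "u \<in> borel_measurable M" "v \<in> borel_measurable M"
    using assms by (auto simp: L2_fun_def)
  have "cnj \<in> borel_measurable borel"
    by (intro borel_measurable_continuous_onI continuous_intros)
  then have [measurable]: "(\<lambda>x. cnj (v x)) \<in> borel_measurable M"
    by measurable
  show "(\<lambda>x. u x * cnj (v x)) \<in> borel_measurable M"
    by measurable
qed

lemma L2_inner_Cauchy_Schwarz:
  assumes u: "u \<in> L2_fun M" and v: "v \<in> L2_fun M"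
  shows "cmod (L2_inner M u v) \<le> sqrt (LINT x|M. (cmod (u x))\<^sup>2) * sqrt (LINT x|M. (cmod (v x))\<^sup>2)"
proof -
  have m[measurable]: "u \<in> borel_measurable M" "v \<in> borel_measurable M"
    and i: "integrable M (\<lambda>x. (cmod (u x))\<^sup>2)" "integrable M (\<lambda>x. (cmod (v x))\<^sup>2)"
    using assms by (auto simp: L2_fun_def)
  have int: "integrable M (\<lambda>x. cmod (u x) * cmod (v x))"
    using integrable_norm[OF L2_inner_integrable[OF u v]] by (simp add: norm_mult)
  define I where "I = (LINT x|M. cmod (u x) * cmod (v x))"
  have I0: "0 \<le> I" by (simp add: I_def)
  have "ennreal (I\<^sup>2) = (\<integral>\<^sup>+x. ennreal (cmod (u x)) * ennreal (cmod (v x)) \<partial>M)\<^sup>2"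
    using nn_integral_eq_integral[OF int] I0 by (simp add: I_def ennreal_mult ennreal_power)
  also have "\<dots> \<le> (\<integral>\<^sup>+x. (ennreal (cmod (u x)))\<^sup>2 \<partial>M) * (\<integral>\<^sup>+x. (ennreal (cmod (v x)))\<^sup>2 \<partial>M)"
    by (rule Cauchy_Schwarz_nn_integral) auto
  also have "\<dots> = ennreal ((LINT x|M. (cmod (u x))\<^sup>2) * (LINT x|M. (cmod (v x))\<^sup>2))"
    using nn_integral_eq_integral[OF i(1)] nn_integral_eq_integral[OF i(2)]
    by (simp add: ennreal_power ennreal_mult)
  finally have "I\<^sup>2 \<le> (LINT x|M. (cmod (u x))\<^sup>2) * (LINT x|M. (cmod (v x))\<^sup>2)"
    by (simp add: ennreal_le_iff)
  then have "I \<le> sqrt (LINT x|M. (cmod (u x))\<^sup>2) * sqrt (LINT x|M. (cmod (v x))\<^sup>2)"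
    by (metis real_le_rsqrt real_sqrt_mult)
  moreover have "cmod (L2_inner M u v) \<le> I"
    unfolding L2_inner_def I_def
    using integral_norm_bound[of M "\<lambda>x. u x * cnj (v x)"] by (simp add: norm_mult)
  ultimately show ?thesis by linarith
qed

section \<open>Square roots of operator graphs\<close>

lemma nonneg_sqrt_cases:
  assumes "is_nonneg_sqrt M B A" "(u, g) \<in> A"
  obtains w where "(u, w) \<in> B" "(w, g) \<in> B"
  using assms by (auto simp: is_nonneg_sqrt_def)

lemma nonneg_sqrt_adjoint:
  assumes "is_nonneg_sqrt M B A" "(p, q) \<in> B" "(u, v) \<in> B"
  shows "L2_inner M q u = L2_inner M p v"
proof -
  have "(u, v) \<in> op_adjoint M B"
    using assms(1,3) by (simp add: is_nonneg_sqrt_def self_adjoint_op_def)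
  with assms(2) show ?thesis
    by (auto simp: op_adjoint_def)
qed

text \<open>B equals its adjoint, and the pairs in an adjoint graph are square integrable by
  definition.\<close>

lemma nonneg_sqrt_L2_fun:
  assumes "is_nonneg_sqrt M B A" "(u, v) \<in> B"
  shows "u \<in> L2_fun M" "v \<in> L2_fun M"
proof -
  have "(u, v) \<in> op_adjoint M B"
    using assms by (simp add: is_nonneg_sqrt_def self_adjoint_op_def)
  then show "u \<in> L2_fun M" "v \<in> L2_fun M"
    by (auto simp: op_adjoint_def)
qed

text \<open>Factoring both pairs through B with intermediate values w and z, each side equals the
  inner product of w and z.\<close>

lemma nonneg_sqrt_symmetric:
  assumes B: "is_nonneg_sqrt M B A" and u: "(u, g) \<in> A" and v: "(v, k) \<in> A"
  shows "L2_inner M g v = L2_inner M u k"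
proof -
  obtain w z where w: "(u, w) \<in> B" "(w, g) \<in> B" and z: "(v, z) \<in> B" "(z, k) \<in> B"
    using nonneg_sqrt_cases[OF B u] nonneg_sqrt_cases[OF B v] by metis
  show ?thesis
    using nonneg_sqrt_adjoint[OF B w(2) z(1)] nonneg_sqrt_adjoint[OF B w(1) z(2)] by simp
qed

text \<open>The representative v chosen by \<open>op_apply\<close> and the intermediate value w with
  (w, g) in B may be different functions. Both are values of B at u, so the adjoint identity makes v
  - w orthogonal to the dense domain of B, hence to v. Therefore the squared norm of v is the inner
  product of v and w, which is that of u and g.\<close>

lemma nonneg_sqrt_norm:
  assumes B: "is_nonneg_sqrt M B A" and u: "(u, g) \<in> A"
  shows "complex_of_real (LINT x|M. (cmod (op_apply B u x))\<^sup>2) = L2_inner M u g"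
proof -
  obtain w where w: "(u, w) \<in> B" "(w, g) \<in> B"
    using nonneg_sqrt_cases[OF B u] .
  define v where "v = op_apply B u"
  have v: "(u, v) \<in> B"
    unfolding v_def op_apply_def using w(1) by (rule someI[of "\<lambda>v. (u, v) \<in> B"])
  note L2 = nonneg_sqrt_L2_fun[OF B]
  have "complex_of_real (LINT x|M. (cmod (v x))\<^sup>2) = (LINT x|M. complex_of_real ((cmod (v x))\<^sup>2))"
    by (rule integral_complex_of_real[symmetric])
  also have "\<dots> = L2_inner M v v"
    unfolding L2_inner_def complex_norm_square ..
  also have "\<dots> = L2_inner M v w"
  proof -
    define d where "d x = v x - w x" for x
    have d: "d \<in> L2_fun M"
      unfolding d_def by (rule L2_fun_diff[OF L2(2)[OF v] L2(2)[OF w(1)]])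
    have split: "L2_inner M p d = L2_inner M p v - L2_inner M p w" if "p \<in> L2_fun M" for p
      unfolding L2_inner_def d_def
      using L2_inner_integrable[OF that L2(2)[OF v]] L2_inner_integrable[OF that L2(2)[OF w(1)]]
      by (simp add: right_diff_distrib)
    have orth: "L2_inner M p d = 0" if p: "p \<in> Domain B" for p
    proof -
      from p obtain q where q: "(p, q) \<in> B" by auto
      then show ?thesis
        using split[OF L2(1)[OF q]] nonneg_sqrt_adjoint[OF B q v] nonneg_sqrt_adjoint[OF B q w(1)] by simp
    qed
    have "L2_inner M v d = 0"
    proof (rule ccontr)
      assume ne: "L2_inner M v d \<noteq> 0"
      define D where "D = sqrt (LINT x|M. (cmod (d x))\<^sup>2)"
      have D0: "D \<ge> 0" by (simp add: D_def)
      \<comment> \<open>Here D is the norm of d. Approximating v within e by a domain element, which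
        is orthogonal to d, bounds the inner product by e D, less than its own value e (D + 1).
        Dividing by D + 1 covers the case D = 0.\<close>
      define e where "e = cmod (L2_inner M v d) / (D + 1)"
      have e: "e > 0" using ne D0 by (simp add: e_def)
      obtain p where p: "p \<in> Domain B" "L2_dist M p v < e"
        using B L2(2)[OF v] e unfolding is_nonneg_sqrt_def self_adjoint_op_def densely_defined_def by blast
      have pL: "p \<in> L2_fun M" using p(1) L2(1) by auto
      have "L2_inner M (\<lambda>x. p x - v x) d = L2_inner M p d - L2_inner M v d"
        unfolding L2_inner_def
        using L2_inner_integrable[OF pL d] L2_inner_integrable[OF L2(2)[OF v] d] by (simp add: left_diff_distrib)
      then have "cmod (L2_inner M v d) = cmod (L2_inner M (\<lambda>x. p x - v x) d)"
        using orth[OF p(1)] by simp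
      also have "\<dots> \<le> L2_dist M p v * D"
        unfolding L2_dist_def D_def by (rule L2_inner_Cauchy_Schwarz[OF L2_fun_diff[OF pL L2(2)[OF v]] d])
      also have "\<dots> \<le> e * D"
        using p(2) D0 by (intro mult_right_mono) auto
      also have "\<dots> < e * (D + 1)"
        using e by simp
      also have "\<dots> = cmod (L2_inner M v d)"
        using D0 by (simp add: e_def)
      finally show False by simp
    qed
    then show ?thesis using split[OF L2(2)[OF v]] by simp
  qed
  also have "\<dots> = L2_inner M u g"
    by (rule nonneg_sqrt_adjoint[OF B v w(2)])
  finally show ?thesis unfolding v_def .
qed

subsection \<open>Weighted inner products\<close>

text \<open>The coefficients of the expanded square are real, so only real parts of cross terms
  occur; taking the real part also makes the form symmetric.\<close>

definition weighted_inner :: "real \<Rightarrow> ('a::euclidean_space \<Rightarrow> complex) \<Rightarrow> ('a \<Rightarrow> complex) \<Rightarrow> real" where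
  "weighted_inner s u v = (LINT x|lborel. norm x powr s * Re (cnj (u x) * v x))"

lemma test_function_cnj_mult:
  "punctured_test_function u \<Longrightarrow> punctured_test_function v \<Longrightarrow> punctured_test_function (\<lambda>x. cnj (u x) * v x)"
  by (intro test_function_mult test_function_smooth[OF test_function_cnj])

lemma
  assumes u: "punctured_test_function u" and v: "punctured_test_function v"
  shows weighted_inner_integrable: "integrable lborel (\<lambda>x. norm x powr s * Re (cnj (u x) * v x))"
    and weighted_inner_eq_Re: "weighted_inner s u v = Re (LINT x|lborel. of_real (norm x powr s) * (cnj (u x) * v x))"
proof -
  have i: "integrable lborel (\<lambda>x. of_real (norm x powr s) * (cnj (u x) * v x))"
    by (intro test_function_integrable test_function_mult smooth_on_scalars test_function_cnj_mult u v)
  then have "integrable lborel (\<lambda>x. Re (of_real (norm x powr s) * (cnj (u x) * v x)))"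
    by (rule integrable_Re)
  then show "integrable lborel (\<lambda>x. norm x powr s * Re (cnj (u x) * v x))"
    by simp
  show "weighted_inner s u v = Re (LINT x|lborel. of_real (norm x powr s) * (cnj (u x) * v x))"
    unfolding weighted_inner_def integral_Re[OF i, symmetric] by simp
qed

lemma weighted_inner_commute: "weighted_inner s u v = weighted_inner s v u"
  unfolding weighted_inner_def by (simp add: mult.commute)

text \<open>E is a derivation commuting with conjugation, so \<open>integral_x_dot_grad\<close>
  applies to conj(u) v: up to the multiple -(n + s) of the identity, E is antisymmetric.\<close>

lemma weighted_inner_x_dot_grad:
  fixes u v :: "'a::euclidean_space \<Rightarrow> complex"
  assumes u: "punctured_test_function u" and v: "punctured_test_function v"
  shows "weighted_inner s (x_dot_grad u) v + weighted_inner s u (x_dot_grad v)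
    = - (real DIM('a) + s) * weighted_inner s u v"
proof -
  note tf = test_function_x_dot_grad u v test_function_cnj_mult
  have E: "x_dot_grad (\<lambda>x. cnj (u x) * v x) x = cnj (x_dot_grad u x) * v x + cnj (u x) * x_dot_grad v x" for x
    by (simp add: x_dot_grad_mult x_dot_grad_cnj differentiable_cnj test_function_differentiable u v)
  have "(LINT x|lborel. of_real (norm x powr s) * (cnj (x_dot_grad u x) * v x))
      + (LINT x|lborel. of_real (norm x powr s) * (cnj (u x) * x_dot_grad v x))
    = (LINT x|lborel. of_real (norm x powr s) * (cnj (x_dot_grad u x) * v x) + of_real (norm x powr s) * (cnj (u x) * x_dot_grad v x))"
    by (intro Bochner_Integration.integral_add[symmetric] test_function_integrable test_function_mult smooth_on_scalars tf)
  also have "\<dots> = (LINT x|lborel. of_real (norm x powr s) * x_dot_grad (\<lambda>x. cnj (u x) * v x) x)"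
    by (simp add: E distrib_left)
  also have "\<dots> = - of_real (real DIM('a) + s) * (LINT x|lborel. of_real (norm x powr s) * (cnj (u x) * v x))"
    by (rule integral_x_dot_grad) (intro tf)
  finally have "Re ((LINT x|lborel. of_real (norm x powr s) * (cnj (x_dot_grad u x) * v x))
      + (LINT x|lborel. of_real (norm x powr s) * (cnj (u x) * x_dot_grad v x)))
      = Re (- of_real (real DIM('a) + s) * (LINT x|lborel. of_real (norm x powr s) * (cnj (u x) * v x)))"
    by (rule arg_cong)
  then show ?thesis
    by (simp add: weighted_inner_eq_Re tf)
qed

text \<open>The first coefficient is fixed at 1 because E^2 f enters both squares to be compared
  with the same coefficient.\<close>

lemma weighted_norm_combination:
  fixes f g h k :: "'a::euclidean_space \<Rightarrow> complex"
  assumes tf: "punctured_test_function f" "punctured_test_function g" "punctured_test_function h" "punctured_test_function k"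
  shows "(LINT x|lborel. norm x powr s * (cmod (f x + of_real a * g x + of_real b * h x + of_real c * k x))\<^sup>2) =
      weighted_inner s f f + a\<^sup>2 * weighted_inner s g g + b\<^sup>2 * weighted_inner s h h + c\<^sup>2 * weighted_inner s k k
      + 2 * a * weighted_inner s f g + 2 * b * weighted_inner s f h + 2 * c * weighted_inner s f k
      + 2 * a * b * weighted_inner s g h + 2 * a * c * weighted_inner s g k + 2 * b * c * weighted_inner s h k"
proof -
  define I where "I u v x = norm x powr s * Re (cnj (u x) * v x)" for u v :: "'a \<Rightarrow> complex" and x
  have int: "integrable lborel (I u v)" if "punctured_test_function u" "punctured_test_function v" for u v
    unfolding I_def[abs_def] using that by (rule weighted_inner_integrable)
  have "norm x powr s * (cmod (f x + of_real a * g x + of_real b * h x + of_real c * k x))\<^sup>2 =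
      I f f x + a\<^sup>2 * I g g x + b\<^sup>2 * I h h x + c\<^sup>2 * I k k x
      + 2 * a * I f g x + 2 * b * I f h x + 2 * c * I f k x
      + 2 * a * b * I g h x + 2 * a * c * I g k x + 2 * b * c * I h k x" for x
    unfolding I_def cmod_power2 by (simp add: power2_eq_square algebra_simps)
  moreover have "weighted_inner s u v = (LINT x|lborel. I u v x)" for u v :: "'a \<Rightarrow> complex"
    by (simp only: weighted_inner_def I_def)
  ultimately show ?thesis
    by (simp add: int tf)
qed

text \<open>Equality is required only of the sphere integrals at each positive radius, since values
  of \<open>op_apply\<close> are known through such integrals alone.\<close>

lemma polar_integral_cong:
  fixes F G :: "real \<Rightarrow> 'a::euclidean_space \<Rightarrow> real"
  assumes "\<And>r. r > 0 \<Longrightarrow> (LINT \<theta>|sphere_measure. F r \<theta>) = (LINT \<theta>|sphere_measure. G r \<theta>)"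
  shows "polar_integral F = polar_integral G"
  unfolding polar_integral_def by (rule set_lebesgue_integral_cong) (auto simp: assms)

lemma weighted_inner_polar:
  fixes u v :: "'a::euclidean_space \<Rightarrow> complex"
  assumes u: "punctured_test_function u" and v: "punctured_test_function v"
  shows "weighted_inner s u v = polar_integral (\<lambda>r \<theta>. r powr s * Re (cnj (u (r *\<^sub>R \<theta>)) * v (r *\<^sub>R \<theta>)))"
proof -
  let ?F = "\<lambda>x. norm x powr s * Re (cnj (u x) * v x)"
  let ?G = "\<lambda>x. of_real (norm x powr s) * (cnj (u x) * v x)"
  have G: "punctured_test_function ?G"
    by (intro test_function_mult smooth_on_scalars test_function_cnj_mult u v)
  have F: "?F = (\<lambda>x. Re (?G x))"
    by auto
  obtain C where C: "\<And>x. cmod (?G x) \<le> C"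
    using bounded_test_function[OF G] by blast
  obtain c where c: "\<And>x. ?G x \<noteq> 0 \<Longrightarrow> norm x \<le> c"
    using test_function_support[OF G] by metis
  have "continuous_on UNIV (\<lambda>x. Re (?G x))"
    by (intro continuous_on_Re test_function_continuous_on G)
  then have m: "?F \<in> borel_measurable borel"
    unfolding F by (rule borel_measurable_continuous_onI)
  have le: "\<bar>?F x\<bar> \<le> C" for x
    using abs_Re_le_cmod[of "?G x"] C[of x] by (simp add: abs_mult)
  have supp: "norm x \<le> c" if "?F x \<noteq> 0" for x
  proof -
    have "cnj (u x) * v x \<noteq> 0" "norm x powr s \<noteq> 0"
      using that by (metis mult_zero_right zero_complex.sel(1), metis mult_zero_left)
    then show ?thesis
      by (intro c) simp
  qed
  have "weighted_inner s u v = polar_integral (\<lambda>r \<theta>. ?F (r *\<^sub>R \<theta>))"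
    unfolding weighted_inner_def by (rule integral_polar[OF m le supp])
  also have "\<dots> = polar_integral (\<lambda>r \<theta>. r powr s * Re (cnj (u (r *\<^sub>R \<theta>)) * v (r *\<^sub>R \<theta>)))"
    by (intro polar_integral_cong Bochner_Integration.integral_cong refl) simp
  finally show ?thesis .
qed

text \<open>The squared norm of the root's value is the inner product of u with minus its
  Laplace-Beltrami image. The scale c is 1 for slices of f and 1 / r for the radial derivative,
  which is Ef divided by r.\<close>

lemma integral_op_apply_dilation:
  fixes h u :: "'a::euclidean_space \<Rightarrow> complex"
  assumes B: "is_nonneg_sqrt sphere_measure B neg_laplace_beltrami_op"
    and h: "punctured_test_function h" and u: "\<And>\<theta>. norm \<theta> = 1 \<Longrightarrow> u \<theta> = of_real c * h (r *\<^sub>R \<theta>)"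
  shows "(LINT \<theta>|sphere_measure. (cmod (op_apply B u \<theta>))\<^sup>2) =
    (LINT \<theta>|sphere_measure. - c\<^sup>2 * Re (cnj (h (r *\<^sub>R \<theta>)) * spherical_laplacian h (r *\<^sub>R \<theta>)))"
proof -
  let ?h = "\<lambda>x. of_real c * h x"
  let ?g = "\<lambda>\<theta>. - laplace_beltrami u \<theta>"
  have h': "punctured_test_function ?h"
    by (intro test_function_cmult h)
  have A: "(u, ?g) \<in> neg_laplace_beltrami_op"
    by (rule neg_laplace_beltrami_op_dilation[OF h' u])
  have L2: "u \<in> L2_fun sphere_measure" "?g \<in> L2_fun sphere_measure"
    using A by (auto simp: neg_laplace_beltrami_op_def op_closure_def)
  have "(LINT \<theta>|sphere_measure. (cmod (op_apply B u \<theta>))\<^sup>2) = Re (L2_inner sphere_measure u ?g)"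
    using nonneg_sqrt_norm[OF B A] by (metis Re_complex_of_real)
  also have "\<dots> = (LINT \<theta>|sphere_measure. Re (u \<theta> * cnj (?g \<theta>)))"
    unfolding L2_inner_def by (rule integral_Re[symmetric, OF L2_inner_integrable[OF L2]])
  also have "\<dots> = (LINT \<theta>|sphere_measure. - c\<^sup>2 * Re (cnj (h (r *\<^sub>R \<theta>)) * spherical_laplacian h (r *\<^sub>R \<theta>)))"
  proof (intro Bochner_Integration.integral_cong refl)
    fix \<theta> :: 'a assume "\<theta> \<in> space sphere_measure"
    then have \<theta>: "norm \<theta> = 1" by simp
    have "laplace_beltrami u \<theta> = of_real c * spherical_laplacian h (r *\<^sub>R \<theta>)"
      using laplace_beltrami_dilation[OF h' u \<theta>] spherical_laplacian_cmult[OF h] by simp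
    then show "Re (u \<theta> * cnj (?g \<theta>)) = - c\<^sup>2 * Re (cnj (h (r *\<^sub>R \<theta>)) * spherical_laplacian h (r *\<^sub>R \<theta>))"
      using u[OF \<theta>] by (simp add: power2_eq_square algebra_simps)
  qed
  finally show ?thesis .
qed

text \<open>The weight is constant on each sphere, so symmetry of the operator on the slices at
  radius r can be multiplied by r^s and integrated over r.\<close>

lemma weighted_inner_spherical_laplacian_symmetric:
  fixes f g :: "'a::euclidean_space \<Rightarrow> complex" and B :: "'a op_graph"
  assumes B: "is_nonneg_sqrt sphere_measure B neg_laplace_beltrami_op"
    and f: "punctured_test_function f" and g: "punctured_test_function g"
  shows "weighted_inner s (spherical_laplacian f) g = weighted_inner s f (spherical_laplacian g)"
proof -
  note tf = test_function_spherical_laplacian f g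
  have "(LINT \<theta>|sphere_measure. r powr s * Re (cnj (spherical_laplacian f (r *\<^sub>R \<theta>)) * g (r *\<^sub>R \<theta>)))
      = (LINT \<theta>|sphere_measure. r powr s * Re (cnj (f (r *\<^sub>R \<theta>)) * spherical_laplacian g (r *\<^sub>R \<theta>)))"
    if "r > 0" for r
  proof -
    define u v where "u \<theta> = f (r *\<^sub>R \<theta>)" and "v \<theta> = g (r *\<^sub>R \<theta>)" for \<theta>
    have u: "(u, \<lambda>\<theta>. - laplace_beltrami u \<theta>) \<in> neg_laplace_beltrami_op"
      and v: "(v, \<lambda>\<theta>. - laplace_beltrami v \<theta>) \<in> neg_laplace_beltrami_op"
      by (rule neg_laplace_beltrami_op_dilation[OF f, of _ r] neg_laplace_beltrami_op_dilation[OF g, of _ r];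
          simp add: u_def v_def)+
    have LB: "laplace_beltrami u \<theta> = spherical_laplacian f (r *\<^sub>R \<theta>)"
       "laplace_beltrami v \<theta> = spherical_laplacian g (r *\<^sub>R \<theta>)" if "norm \<theta> = 1" for \<theta>
      using laplace_beltrami_dilation[OF f _ that, of u r] laplace_beltrami_dilation[OF g _ that, of v r]
      by (auto simp: u_def v_def)
    have L2: "u \<in> L2_fun sphere_measure" "v \<in> L2_fun sphere_measure"
      "(\<lambda>\<theta>. - laplace_beltrami u \<theta>) \<in> L2_fun sphere_measure" "(\<lambda>\<theta>. - laplace_beltrami v \<theta>) \<in> L2_fun sphere_measure"
      using u v by (auto simp: neg_laplace_beltrami_op_def op_closure_def)
    have "(LINT \<theta>|sphere_measure. Re (- laplace_beltrami u \<theta> * cnj (v \<theta>))) =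
        (LINT \<theta>|sphere_measure. Re (u \<theta> * cnj (- laplace_beltrami v \<theta>)))"
      using arg_cong[OF nonneg_sqrt_symmetric[OF B u v], of Re]
      unfolding L2_inner_def integral_Re[OF L2_inner_integrable[OF L2(3,2)], symmetric]
        integral_Re[OF L2_inner_integrable[OF L2(1,4)], symmetric] .
    moreover have "(LINT \<theta>|sphere_measure. Re (- laplace_beltrami u \<theta> * cnj (v \<theta>))) =
        (LINT \<theta>|sphere_measure. - Re (cnj (spherical_laplacian f (r *\<^sub>R \<theta>)) * g (r *\<^sub>R \<theta>)))"
      by (intro Bochner_Integration.integral_cong refl) (simp add: LB, simp add: v_def)
    moreover have "(LINT \<theta>|sphere_measure. Re (u \<theta> * cnj (- laplace_beltrami v \<theta>))) =
        (LINT \<theta>|sphere_measure. - Re (cnj (f (r *\<^sub>R \<theta>)) * spherical_laplacian g (r *\<^sub>R \<theta>)))"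
      by (intro Bochner_Integration.integral_cong refl) (simp add: LB, simp add: u_def)
    ultimately have "(LINT \<theta>|sphere_measure. - Re (cnj (spherical_laplacian f (r *\<^sub>R \<theta>)) * g (r *\<^sub>R \<theta>)))
        = (LINT \<theta>|sphere_measure. - Re (cnj (f (r *\<^sub>R \<theta>)) * spherical_laplacian g (r *\<^sub>R \<theta>)))"
      by metis
    then show ?thesis
      by (simp only: Bochner_Integration.integral_minus neg_equal_iff_equal integral_mult_right_zero)
  qed
  then show ?thesis
    unfolding weighted_inner_polar[OF tf(1)[OF f] g] weighted_inner_polar[OF f tf(1)[OF g]]
    by (rule polar_integral_cong)
qed

lemma radial_deriv_eq:
  assumes "f differentiable at (r *\<^sub>R \<theta>)" "r \<noteq> 0"
  shows "radial_deriv f r \<theta> = of_real (1 / r) * x_dot_grad f (r *\<^sub>R \<theta>)"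
proof -
  interpret linear "frechet_derivative f (at (r *\<^sub>R \<theta>))"
    by (rule linear_frechet_derivative[OF assms(1)])
  have "((\<lambda>s. f (s *\<^sub>R \<theta>)) has_derivative (\<lambda>h. frechet_derivative f (at (r *\<^sub>R \<theta>)) (h *\<^sub>R \<theta>))) (at r)"
    by (rule has_derivative_compose[of "\<lambda>s. s *\<^sub>R \<theta>" "\<lambda>h. h *\<^sub>R \<theta>" r UNIV f])
       (use assms frechet_derivative_works in \<open>auto intro!: derivative_eq_intros\<close>)
  then have "((\<lambda>s. f (s *\<^sub>R \<theta>)) has_vector_derivative frechet_derivative f (at (r *\<^sub>R \<theta>)) \<theta>) (at r)"
    by (simp add: has_vector_derivative_def scale)
  then have "radial_deriv f r \<theta> = frechet_derivative f (at (r *\<^sub>R \<theta>)) \<theta>"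
    unfolding radial_deriv_def by (rule vector_derivative_at)
  moreover have "x_dot_grad f (r *\<^sub>R \<theta>) = r *\<^sub>R frechet_derivative f (at (r *\<^sub>R \<theta>)) \<theta>"
    unfolding x_dot_grad_eq_frechet[OF assms(1)] by (rule scale)
  ultimately show ?thesis
    using assms(2) by (simp add: scaleR_conv_of_real)
qed

lemma cmod_x_dot_grad_le: "cmod (x_dot_grad f x) \<le> norm x * grad_norm f x"
proof -
  have "cmod (x_dot_grad f x) \<le> (\<Sum>b\<in>Basis. \<bar>x \<bullet> b\<bar> * \<bar>cmod (partial_deriv b f x)\<bar>)"
    unfolding x_dot_grad_def by (rule order_trans[OF norm_sum]) (simp add: norm_mult)
  also have "\<dots> \<le> L2_set (\<lambda>b. x \<bullet> b) Basis * L2_set (\<lambda>b. cmod (partial_deriv b f x)) Basis"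
    by (rule L2_set_mult_ineq)
  also have "L2_set (\<lambda>b. x \<bullet> b) Basis = norm x"
    unfolding L2_set_def by (rule euclidean_dist_l2[of x 0, unfolded L2_set_def, simplified, symmetric])
  finally show ?thesis
    by (simp add: L2_set_def grad_norm_def)
qed

section \<open>The expanded square and the two inequalities\<close>

lemma Re_cnj_mult_self: "Re (cnj z * z) = (cmod z)\<^sup>2"
  by (simp add: cmod_power2) (simp add: power2_eq_square)

text \<open>Here aij stands for the weighted inner product of E^i f and E^j f, bj for that of E^j f
  and \<Lambda>f, ej for that of E^j f and \<Lambda>Ef, and c for that of \<Lambda>f with itself.
  The relations eliminate all but a00, a11, a22, b0, b2 and c. On the right stand the integral of
  |\<Delta>f|^2 and the lower bound; the factor with a02, a01 and b0 is the gradient integral, and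
  -b0 and -e1 are the two square-root integrals.\<close>

lemma factored_square_identity:
  fixes \<alpha> \<beta> \<gamma> \<tau> n a00 a01 a02 a11 a12 a22 b0 b1 b2 c e0 e1 :: real
  assumes "2 * a01 = - (n + \<gamma> - 4) * a00" "a11 + a02 = - (n + \<gamma> - 4) * a01" "2 * a12 = - (n + \<gamma> - 4) * a11"
    "e0 = b1" "b1 + e0 = - (n + \<gamma> - 4) * b0" "b2 + e1 = - (n + \<gamma> - 4) * b1"
  shows "a22 + (n - 2 - \<alpha>)\<^sup>2 * a11 + (- \<beta>)\<^sup>2 * a00 + (1 + \<tau>)\<^sup>2 * c
      + 2 * (n - 2 - \<alpha>) * a12 + 2 * (- \<beta>) * a02 + 2 * (1 + \<tau>) * b2
      + 2 * (n - 2 - \<alpha>) * (- \<beta>) * a01 + 2 * (n - 2 - \<alpha>) * (1 + \<tau>) * b1 + 2 * (- \<beta>) * (1 + \<tau>) * b0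
    = (a22 + (n - 2)\<^sup>2 * a11 + c + 2 * (n - 2) * a12 + 2 * b2 + 2 * (n - 2) * b1)
      - ((\<alpha> * (\<gamma> + n - 4) - 2 * \<beta>) * (- (a02 + (n - 2) * a01 + b0) - (\<gamma> - 2) * a01)
         - \<alpha> * (\<alpha> - 4 + 2 * \<gamma>) * a11
         + \<beta> * ((n - 4) * (\<alpha> - 2) - \<beta> + \<gamma> * (n + \<alpha> + \<gamma> - 6)) * a00
         - \<tau> * ((\<gamma> + n - 4) * (2 - \<alpha> - \<gamma>) + 2 * \<beta>) * (- b0)
         - 2 * \<tau> * (- e1) - \<tau> * (\<tau> + 2) * c)"
proof -
  \<comment> \<open>N is the constant n + s of integration by parts at s = \<gamma> - 4, the only
    way in which n and \<gamma> enter the relations.\<close>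
  define N where "N = n + \<gamma> - 4"
  have n: "n = N - \<gamma> + 4" by (simp add: N_def)
  have a01: "a01 = - (N * a00) / 2" and b1: "b1 = - (N * b0) / 2" and e0: "e0 = - (N * b0) / 2" and a12: "a12 = - (N * a11) / 2"
    using assms unfolding N_def[symmetric] by auto
  have a02: "a02 = N * (N * a00) / 2 - a11" and e1: "e1 = N * (N * b0) / 2 - b2"
    using assms(2,6) unfolding N_def[symmetric] a01 b1 by (auto simp: field_simps)
  show ?thesis
    unfolding a01 b1 a12 a02 e1 n by (simp add: field_simps power2_eq_square)
qed

theorem theorem3p1:
  fixes \<alpha> \<beta> \<gamma> \<tau> :: real
    and n :: nat
    and f :: "'a::euclidean_space \<Rightarrow> complex"
    and B :: "'a op_graph"
  assumes "DIM('a) = n" and "n \<ge> 2"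
    and "test_function (- {0}) f"
    and "is_nonneg_sqrt sphere_measure B neg_laplace_beltrami_op"
  shows "((LINT x|lborel. norm x powr \<gamma> * (cmod (laplacian f x))\<^sup>2)
         \<ge> (\<alpha> * (\<gamma> + real n - 4) - 2 * \<beta>)
               * (LINT x|lborel. norm x powr (\<gamma> - 2) * (grad_norm f x)\<^sup>2)
           - \<alpha> * (\<alpha> - 4 + 2 * \<gamma>)
               * (LINT x|lborel. norm x powr (\<gamma> - 4) * (cmod (x_dot_grad f x))\<^sup>2)
           + \<beta> * ((real n - 4) * (\<alpha> - 2) - \<beta> + \<gamma> * (real n + \<alpha> + \<gamma> - 6))
               * (LINT x|lborel. norm x powr (\<gamma> - 4) * (cmod (f x))\<^sup>2)
           - \<tau> * ((\<gamma> + real n - 4) * (2 - \<alpha> - \<gamma>) + 2 * \<beta>)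
               * polar_integral (\<lambda>r \<theta>. r powr (\<gamma> - 4)
                   * (cmod (op_apply B (\<lambda>\<omega>. f (r *\<^sub>R \<omega>)) \<theta>))\<^sup>2)
           - 2 * \<tau>
               * polar_integral (\<lambda>r \<theta>. r powr (\<gamma> - 2)
                   * (cmod (op_apply B (radial_deriv f r) \<theta>))\<^sup>2)
           - \<tau> * (\<tau> + 2)
               * polar_integral (\<lambda>r \<theta>. r powr (\<gamma> - 4)
                   * (cmod (laplace_beltrami (\<lambda>\<omega>. f (r *\<^sub>R \<omega>)) \<theta>))\<^sup>2))
    \<and> (\<alpha> * (\<alpha> - 4 + 2 * \<gamma>) \<ge> 0 \<longrightarrow>
         (LINT x|lborel. norm x powr \<gamma> * (cmod (laplacian f x))\<^sup>2)
         \<ge> (\<alpha> * (real n - \<alpha> - \<gamma>) - 2 * \<beta>)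
               * (LINT x|lborel. norm x powr (\<gamma> - 2) * (grad_norm f x)\<^sup>2)
           + \<beta> * ((real n - 4) * (\<alpha> - 2) - \<beta> + \<gamma> * (real n + \<alpha> + \<gamma> - 6))
               * (LINT x|lborel. norm x powr (\<gamma> - 4) * (cmod (f x))\<^sup>2)
           - \<tau> * ((\<gamma> + real n - 4) * (2 - \<alpha> - \<gamma>) + 2 * \<beta>)
               * polar_integral (\<lambda>r \<theta>. r powr (\<gamma> - 4)
                   * (cmod (op_apply B (\<lambda>\<omega>. f (r *\<^sub>R \<omega>)) \<theta>))\<^sup>2)
           - 2 * \<tau>
               * polar_integral (\<lambda>r \<theta>. r powr (\<gamma> - 2)
                   * (cmod (op_apply B (radial_deriv f r) \<theta>))\<^sup>2)
           - \<tau> * (\<tau> + 2)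
               * polar_integral (\<lambda>r \<theta>. r powr (\<gamma> - 4)
                   * (cmod (laplace_beltrami (\<lambda>\<omega>. f (r *\<^sub>R \<omega>)) \<theta>))\<^sup>2))"
proof -
  let ?s = "\<gamma> - 4"
  define f1 f2 l0 l1 where "f1 = x_dot_grad f" and "f2 = x_dot_grad f1"
    and "l0 = spherical_laplacian f" and "l1 = spherical_laplacian f1"
  note f = assms(3) and B = assms(4)
  have tf: "punctured_test_function f1" "punctured_test_function f2" "punctured_test_function l0" "punctured_test_function l1"
    unfolding f1_def f2_def l0_def l1_def
    by (intro test_function_x_dot_grad test_function_spherical_laplacian f)+
  have El0: "x_dot_grad l0 = l1"
    unfolding l0_def l1_def f1_def by (rule ext) (rule spherical_laplacian_x_dot_grad[OF f, symmetric])
  \<comment> \<open>The coefficients 0 and 1 are spelled out so that |x|^2 \<Delta>f is a member of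
    the family whose weighted norm is \<open>Q a b c\<close>.\<close>
  have lap: "of_real (x \<bullet> x) * laplacian f x = f2 x + of_real (real n - 2) * f1 x + of_real 0 * f x + of_real 1 * l0 x" for x
    by (simp add: l0_def spherical_laplacian_def f2_def f1_def assms(1))
  let ?W = "weighted_inner ?s"
  \<comment> \<open>All integrals are brought to the common weight |x|^(\<gamma>-4); the spare
    powers of |x| turn \<Delta> into |x|^2 \<Delta>.\<close>
  have powr4: "norm x powr \<gamma> = norm x powr ?s * (x \<bullet> x)\<^sup>2" if "x \<noteq> 0" for x :: 'a
    using that powr_add[of "norm x" 4 ?s] by (simp add: power2_norm_eq_inner[symmetric] mult.commute)
  have powr2: "norm x powr (\<gamma> - 2) = norm x powr ?s * (x \<bullet> x)" if "x \<noteq> 0" for x :: 'a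
    using that powr_add[of "norm x" 2 ?s] by (simp add: power2_norm_eq_inner[symmetric] mult.commute)
  have zero: "f 0 = 0" "laplacian f 0 = 0"
    by (rule test_function_zero_at_0[OF f] test_function_zero_at_0[OF test_function_laplacian[OF f]])+
  define Q where "Q a b c = (LINT x|lborel. norm x powr ?s * (cmod (f2 x + of_real a * f1 x + of_real b * f x + of_real c * l0 x))\<^sup>2)" for a b c
  have Q: "Q a b c = ?W f2 f2 + a\<^sup>2 * ?W f1 f1 + b\<^sup>2 * ?W f f + c\<^sup>2 * ?W l0 l0
      + 2 * a * ?W f1 f2 + 2 * b * ?W f f2 + 2 * c * ?W f2 l0
      + 2 * a * b * ?W f f1 + 2 * a * c * ?W f1 l0 + 2 * b * c * ?W f l0" for a b c
    unfolding Q_def weighted_norm_combination[OF tf(2,1) f tf(3)]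
    by (simp only: weighted_inner_commute[of _ f2 f1] weighted_inner_commute[of _ f2 f] weighted_inner_commute[of _ f1 f])
  have Lap: "(LINT x|lborel. norm x powr \<gamma> * (cmod (laplacian f x))\<^sup>2) = Q (real n - 2) 0 1"
    unfolding Q_def
  proof (intro Bochner_Integration.integral_cong refl)
    fix x :: 'a
    show "norm x powr \<gamma> * (cmod (laplacian f x))\<^sup>2 = norm x powr ?s *
        (cmod (f2 x + of_real (real n - 2) * f1 x + of_real 0 * f x + of_real 1 * l0 x))\<^sup>2"
      unfolding lap[symmetric]
      by (cases "x = 0") (auto simp: powr4 zero norm_mult power_mult_distrib)
  qed
  \<comment> \<open>Green's identity at exponent \<gamma> - 2 leaves an inner product of f with
    \<Delta>f, where |x|^2 \<Delta> is split into its radial and spherical parts.\<close>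
  have Grad: "(LINT x|lborel. norm x powr (\<gamma> - 2) * (grad_norm f x)\<^sup>2)
      = - (?W f f2 + (real n - 2) * ?W f f1 + ?W f l0) - (\<gamma> - 2) * ?W f f1"
  proof -
    have "(LINT x|lborel. norm x powr (\<gamma> - 2) * (grad_norm f x)\<^sup>2)
        = - weighted_inner (\<gamma> - 2) f (laplacian f) - (\<gamma> - 2) * weighted_inner (\<gamma> - 2 - 2) f f1"
      using arg_cong[OF integral_grad_norm(1)[OF f, of "\<gamma> - 2"], of Re]
      by (simp add: weighted_inner_eq_Re f test_function_x_dot_grad test_function_laplacian f1_def del: of_real_diff)
    also have "weighted_inner (\<gamma> - 2) f (laplacian f) =
        (LINT x|lborel. norm x powr ?s * Re (cnj (f x) * f2 x)
          + (real n - 2) * (norm x powr ?s * Re (cnj (f x) * f1 x)) + norm x powr ?s * Re (cnj (f x) * l0 x))"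
      unfolding weighted_inner_def
    proof (intro Bochner_Integration.integral_cong refl)
      fix x :: 'a
      have "Re (cnj (f x) * (of_real (x \<bullet> x) * laplacian f x)) =
          Re (cnj (f x) * f2 x) + (real n - 2) * Re (cnj (f x) * f1 x) + Re (cnj (f x) * l0 x)"
        unfolding lap by (simp add: algebra_simps)
      moreover have "Re (cnj (f x) * (of_real (x \<bullet> x) * laplacian f x)) = (x \<bullet> x) * Re (cnj (f x) * laplacian f x)"
        by (simp add: algebra_simps)
      ultimately have "(x \<bullet> x) * Re (cnj (f x) * laplacian f x) =
          Re (cnj (f x) * f2 x) + (real n - 2) * Re (cnj (f x) * f1 x) + Re (cnj (f x) * l0 x)"
        by metis
      then have "norm x powr ?s * ((x \<bullet> x) * Re (cnj (f x) * laplacian f x)) =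
          norm x powr ?s * Re (cnj (f x) * f2 x) + (real n - 2) * (norm x powr ?s * Re (cnj (f x) * f1 x))
          + norm x powr ?s * Re (cnj (f x) * l0 x)"
        by (simp only: distrib_left mult.left_commute)
      then show "norm x powr (\<gamma> - 2) * Re (cnj (f x) * laplacian f x) =
          norm x powr ?s * Re (cnj (f x) * f2 x) + (real n - 2) * (norm x powr ?s * Re (cnj (f x) * f1 x))
          + norm x powr ?s * Re (cnj (f x) * l0 x)"
        by (cases "x = 0") (simp_all add: powr2 zero mult.assoc del: times_complex.sel)
    qed
    also have "\<dots> = ?W f f2 + (real n - 2) * ?W f f1 + ?W f l0"
      unfolding weighted_inner_def
      using weighted_inner_integrable[OF f tf(1), of ?s] weighted_inner_integrable[OF f tf(2), of ?s]
        weighted_inner_integrable[OF f tf(3), of ?s]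
      by (simp del: times_complex.sel)
    finally show ?thesis by simp
  qed
  have XGrad: "(LINT x|lborel. norm x powr ?s * (cmod (x_dot_grad f x))\<^sup>2) = ?W f1 f1"
    and F0: "(LINT x|lborel. norm x powr ?s * (cmod (f x))\<^sup>2) = ?W f f"
    unfolding weighted_inner_def f1_def Re_cnj_mult_self by (rule refl)+
  have P1: "polar_integral (\<lambda>r \<theta>. r powr ?s * (cmod (op_apply B (\<lambda>\<omega>. f (r *\<^sub>R \<omega>)) \<theta>))\<^sup>2) = - ?W f l0"
  proof -
    have "polar_integral (\<lambda>r \<theta>. r powr ?s * (cmod (op_apply B (\<lambda>\<omega>. f (r *\<^sub>R \<omega>)) \<theta>))\<^sup>2) =
        polar_integral (\<lambda>r \<theta>. - (r powr ?s * Re (cnj (f (r *\<^sub>R \<theta>)) * l0 (r *\<^sub>R \<theta>))))"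
    proof (rule polar_integral_cong)
      fix r :: real
      have "(LINT \<theta>|sphere_measure. (cmod (op_apply B (\<lambda>\<omega>. f (r *\<^sub>R \<omega>)) \<theta>))\<^sup>2)
          = (LINT \<theta>|sphere_measure. - 1\<^sup>2 * Re (cnj (f (r *\<^sub>R \<theta>)) * l0 (r *\<^sub>R \<theta>)))"
        unfolding l0_def by (rule integral_op_apply_dilation[OF B f]) simp
      then show "(LINT \<theta>|sphere_measure. r powr ?s * (cmod (op_apply B (\<lambda>\<omega>. f (r *\<^sub>R \<omega>)) \<theta>))\<^sup>2)
          = (LINT \<theta>|sphere_measure. - (r powr ?s * Re (cnj (f (r *\<^sub>R \<theta>)) * l0 (r *\<^sub>R \<theta>))))"
        by (simp del: times_complex.sel)
    qed
    then show ?thesis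
      by (simp add: weighted_inner_polar[OF f tf(3)] polar_integral_def set_lebesgue_integral_def del: times_complex.sel)
  qed
  have P2: "polar_integral (\<lambda>r \<theta>. r powr (\<gamma> - 2) * (cmod (op_apply B (radial_deriv f r) \<theta>))\<^sup>2) = - ?W f1 l1"
  proof -
    have "polar_integral (\<lambda>r \<theta>. r powr (\<gamma> - 2) * (cmod (op_apply B (radial_deriv f r) \<theta>))\<^sup>2) =
        polar_integral (\<lambda>r \<theta>. - (r powr ?s * Re (cnj (f1 (r *\<^sub>R \<theta>)) * l1 (r *\<^sub>R \<theta>))))"
    proof (rule polar_integral_cong)
      fix r :: real assume r: "r > 0"
      have "(LINT \<theta>|sphere_measure. (cmod (op_apply B (radial_deriv f r) \<theta>))\<^sup>2)
          = (LINT \<theta>|sphere_measure. - (1 / r)\<^sup>2 * Re (cnj (f1 (r *\<^sub>R \<theta>)) * l1 (r *\<^sub>R \<theta>)))"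
        unfolding l1_def
      proof (rule integral_op_apply_dilation[OF B tf(1)])
        show "radial_deriv f r \<theta> = of_real (1 / r) * f1 (r *\<^sub>R \<theta>)" for \<theta>
          unfolding f1_def by (rule radial_deriv_eq[OF test_function_differentiable[OF f]]) (use r in simp)
      qed
      \<comment> \<open>Writing the radial derivative as Ef / r costs r^(-2), which brings this
        integral to the common weight.\<close>
      moreover have "r powr (\<gamma> - 2) * (1 / r)\<^sup>2 = r powr ?s"
        using r powr_add[of r 2 ?s] by (simp add: power2_eq_square)
      ultimately show "(LINT \<theta>|sphere_measure. r powr (\<gamma> - 2) * (cmod (op_apply B (radial_deriv f r) \<theta>))\<^sup>2)
          = (LINT \<theta>|sphere_measure. - (r powr ?s * Re (cnj (f1 (r *\<^sub>R \<theta>)) * l1 (r *\<^sub>R \<theta>))))"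
        by (simp flip: mult.assoc del: times_complex.sel power_one_over)
    qed
    then show ?thesis
      by (simp add: weighted_inner_polar[OF tf(1,4)] polar_integral_def set_lebesgue_integral_def del: times_complex.sel)
  qed
  have P3: "polar_integral (\<lambda>r \<theta>. r powr ?s * (cmod (laplace_beltrami (\<lambda>\<omega>. f (r *\<^sub>R \<omega>)) \<theta>))\<^sup>2) = ?W l0 l0"
    unfolding weighted_inner_polar[OF tf(3,3)]
  proof (intro polar_integral_cong Bochner_Integration.integral_cong refl)
    fix r :: real and \<theta> :: 'a assume "\<theta> \<in> space sphere_measure"
    then have "laplace_beltrami (\<lambda>\<omega>. f (r *\<^sub>R \<omega>)) \<theta> = l0 (r *\<^sub>R \<theta>)"
      unfolding l0_def by (intro laplace_beltrami_dilation[OF f]) auto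
    then show "r powr ?s * (cmod (laplace_beltrami (\<lambda>\<omega>. f (r *\<^sub>R \<omega>)) \<theta>))\<^sup>2 =
        r powr ?s * Re (cnj (l0 (r *\<^sub>R \<theta>)) * l0 (r *\<^sub>R \<theta>))"
      by (simp only: Re_cnj_mult_self)
  qed
  have euler: "?W (x_dot_grad u) v + ?W u (x_dot_grad v) = - (real n + \<gamma> - 4) * ?W u v"
    if "punctured_test_function u" "punctured_test_function v" for u v :: "'a \<Rightarrow> complex"
    using weighted_inner_x_dot_grad[OF that, of ?s] by (simp add: assms(1) algebra_simps)
  \<comment> \<open>Five instances of integration by parts and one of the symmetry of \<Lambda>.
    Since E\<Lambda>f = \<Lambda>Ef, moving E off f or Ef against \<Lambda>f produces no new
    function.\<close>
  have rel: "2 * ?W f f1 = - (real n + \<gamma> - 4) * ?W f f"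
    "?W f1 f1 + ?W f f2 = - (real n + \<gamma> - 4) * ?W f f1"
    "2 * ?W f1 f2 = - (real n + \<gamma> - 4) * ?W f1 f1"
    "?W f l1 = ?W f1 l0"
    "?W f1 l0 + ?W f l1 = - (real n + \<gamma> - 4) * ?W f l0"
    "?W f2 l0 + ?W f1 l1 = - (real n + \<gamma> - 4) * ?W f1 l0"
    using euler[OF f f] euler[OF f tf(1)] euler[OF tf(1,1)] euler[OF f tf(3)] euler[OF tf(1,3)]
      weighted_inner_spherical_laplacian_symmetric[OF B f tf(1), of ?s]
    by (simp_all add: El0 weighted_inner_commute flip: f1_def f2_def l0_def l1_def)
  \<comment> \<open>The coefficients (n - 2, 0, 1) of |x|^2 \<Delta>f are shifted by (-\<alpha>,
    -\<beta>, \<tau>).\<close>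
  have "0 \<le> Q (real n - 2 - \<alpha>) (- \<beta>) (1 + \<tau>)"
    unfolding Q_def by (intro Bochner_Integration.integral_nonneg) simp
  also have "\<dots> = Q (real n - 2) 0 1 - ((\<alpha> * (\<gamma> + real n - 4) - 2 * \<beta>) * (- (?W f f2 + (real n - 2) * ?W f f1 + ?W f l0) - (\<gamma> - 2) * ?W f f1)
         - \<alpha> * (\<alpha> - 4 + 2 * \<gamma>) * ?W f1 f1
         + \<beta> * ((real n - 4) * (\<alpha> - 2) - \<beta> + \<gamma> * (real n + \<alpha> + \<gamma> - 6)) * ?W f f
         - \<tau> * ((\<gamma> + real n - 4) * (2 - \<alpha> - \<gamma>) + 2 * \<beta>) * (- ?W f l0)
         - 2 * \<tau> * (- ?W f1 l1) - \<tau> * (\<tau> + 2) * ?W l0 l0)"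
    unfolding Q factored_square_identity[OF rel] by simp
  finally have main: "Q (real n - 2) 0 1 \<ge> (\<alpha> * (\<gamma> + real n - 4) - 2 * \<beta>) * (LINT x|lborel. norm x powr (\<gamma> - 2) * (grad_norm f x)\<^sup>2)
         - \<alpha> * (\<alpha> - 4 + 2 * \<gamma>) * ?W f1 f1
         + \<beta> * ((real n - 4) * (\<alpha> - 2) - \<beta> + \<gamma> * (real n + \<alpha> + \<gamma> - 6)) * ?W f f
         - \<tau> * ((\<gamma> + real n - 4) * (2 - \<alpha> - \<gamma>) + 2 * \<beta>) * (- ?W f l0)
         - 2 * \<tau> * (- ?W f1 l1) - \<tau> * (\<tau> + 2) * ?W l0 l0"
    unfolding Grad by simp
  have le: "?W f1 f1 \<le> (LINT x|lborel. norm x powr (\<gamma> - 2) * (grad_norm f x)\<^sup>2)"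
    unfolding weighted_inner_def
  proof (rule integral_mono[OF weighted_inner_integrable[OF tf(1,1)] integral_grad_norm(2)[OF f]])
    fix x :: 'a
    show "norm x powr ?s * Re (cnj (f1 x) * f1 x) \<le> norm x powr (\<gamma> - 2) * (grad_norm f x)\<^sup>2"
    proof (cases "x = 0")
      case False
      have "Re (cnj (f1 x) * f1 x) = (cmod (f1 x))\<^sup>2"
        by (rule Re_cnj_mult_self)
      also have "\<dots> \<le> (norm x * grad_norm f x)\<^sup>2"
        unfolding f1_def by (intro power_mono cmod_x_dot_grad_le) simp
      also have "\<dots> = (x \<bullet> x) * (grad_norm f x)\<^sup>2"
        by (simp add: power_mult_distrib power2_norm_eq_inner)
      finally show ?thesis
        unfolding powr2[OF False] mult.assoc by (rule mult_left_mono) simp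
    qed simp
  qed
  show ?thesis
    unfolding Lap XGrad F0 P1 P2 P3
  proof (intro conjI impI)
    show "Q (real n - 2) 0 1 \<ge> (\<alpha> * (\<gamma> + real n - 4) - 2 * \<beta>) * (LINT x|lborel. norm x powr (\<gamma> - 2) * (grad_norm f x)\<^sup>2)
         - \<alpha> * (\<alpha> - 4 + 2 * \<gamma>) * ?W f1 f1
         + \<beta> * ((real n - 4) * (\<alpha> - 2) - \<beta> + \<gamma> * (real n + \<alpha> + \<gamma> - 6)) * ?W f f
         - \<tau> * ((\<gamma> + real n - 4) * (2 - \<alpha> - \<gamma>) + 2 * \<beta>) * (- ?W f l0)
         - 2 * \<tau> * (- ?W f1 l1) - \<tau> * (\<tau> + 2) * ?W l0 l0"
      by (rule main)
    assume "0 \<le> \<alpha> * (\<alpha> - 4 + 2 * \<gamma>)"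
    then have "\<alpha> * (\<alpha> - 4 + 2 * \<gamma>) * ?W f1 f1 \<le> \<alpha> * (\<alpha> - 4 + 2 * \<gamma>) * (LINT x|lborel. norm x powr (\<gamma> - 2) * (grad_norm f x)\<^sup>2)"
      by (intro mult_left_mono le)
    \<comment> \<open>The sign condition lets the subtracted integral of |Ef|^2 be replaced by the
      larger gradient integral, whose coefficient drops by \<alpha>(\<alpha> - 4 + 2\<gamma>) to the
      one in the second inequality.\<close>
    moreover have "\<alpha> * (real n - \<alpha> - \<gamma>) - 2 * \<beta> = (\<alpha> * (\<gamma> + real n - 4) - 2 * \<beta>) - \<alpha> * (\<alpha> - 4 + 2 * \<gamma>)"
      by (simp add: algebra_simps)
    ultimately show "Q (real n - 2) 0 1 \<ge> (\<alpha> * (real n - \<alpha> - \<gamma>) - 2 * \<beta>) * (LINT x|lborel. norm x powr (\<gamma> - 2) * (grad_norm f x)\<^sup>2)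
         + \<beta> * ((real n - 4) * (\<alpha> - 2) - \<beta> + \<gamma> * (real n + \<alpha> + \<gamma> - 6)) * ?W f f
         - \<tau> * ((\<gamma> + real n - 4) * (2 - \<alpha> - \<gamma>) + 2 * \<beta>) * (- ?W f l0)
         - 2 * \<tau> * (- ?W f1 l1) - \<tau> * (\<tau> + 2) * ?W l0 l0"
      using main by (simp add: left_diff_distrib)
  qed
qed

end
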